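(* Let $\Omega$ be a bounded domain in $\mathbb{C}^n$. (1) If $f$ is a holomorphic function on $\Omega$ with $$\int_\Omega|f|^2\,\delta_\Omega^{-1}\left(1+|\log\delta_\Omega|\right)^{-1}dV<\infty,$$ then $f=0$. In particular, $A^2_\alpha(\Omega)=\{0\}$ for each $\alpha\ge1$. (2) Let $\alpha$ be a real number, let $\Omega_\varepsilon=\{z\in\Omega:\delta_\Omega(z)>\varepsilon\}$ and let $c(\varepsilon):=\mathrm{cap}\left(\overline{\Omega}_\varepsilon,\Omega\right)$ denote the capacity of $\overline{\Omega}_\varepsilon$ in $\Omega$. Suppose there is a sequence $\varepsilon_j\to0+$ such that $c(\varepsilon_j)=O(\varepsilon_j^{-\alpha})$. Then $A^2_\alpha(\Omega)=\{0\}$.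
   Context: $\delta_\Omega(z)$ is the Euclidean distance from $z\in\Omega$ to $\partial\Omega$ and $dV$ is Lebesgue measure. For real $\alpha$, $A^2_\alpha(\Omega)$ is the space of holomorphic functions $f$ on $\Omega$ with $\int_\Omega|f|^2\delta_\Omega^{-\alpha}\,dV<\infty$. For a compact set $M\subset\Omega$, the capacity of $M$ in $\Omega$ is $\mathrm{cap}(M,\Omega)=\inf\int_\Omega|\nabla\phi|^2dV$, where the infimum is over all $\phi\in C_0^\infty(\Omega)$ with $0\le\phi\le1$ and $\phi=1$ in a neighborhood of $M$. *)

theory Defs
  imports "HOL-Analysis.Analysis"
begin

text \<open>Complex Frechet differentiability at every point; meant for open sets, where it is one of
  the standard definitions of holomorphy in several variables. The library's
  \<^const>\<open>holomorphic_on\<close> only covers functions of one variable.\<close>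

definition holomorphic_several_on :: "(complex ^ 'n \<Rightarrow> complex) \<Rightarrow> (complex ^ 'n) set \<Rightarrow> bool" where
  "holomorphic_several_on f S \<longleftrightarrow>
     (\<forall>z\<in>S. \<exists>D. (f has_derivative D) (at z) \<and> (\<forall>c v. D (c *s v) = c * D v))"

definition bdist :: "'a::metric_space set \<Rightarrow> 'a \<Rightarrow> real" where
  "bdist \<Omega> z = infdist z (frontier \<Omega>)"

text \<open>Functions on \<open>\<Omega>\<close> are represented by total functions that vanish off \<open>\<Omega>\<close>, so that equality of
  members of the space is equality on \<open>\<Omega>\<close>.\<close>

definition weighted_bergman :: "real \<Rightarrow> (complex ^ 'n) set \<Rightarrow> (complex ^ 'n \<Rightarrow> complex) set" where
  "weighted_bergman \<alpha> \<Omega> =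
     {f. holomorphic_several_on f \<Omega> \<and> (\<forall>z. z \<notin> \<Omega> \<longrightarrow> f z = 0) \<and>
         (\<integral>\<^sup>+z\<in>\<Omega>. ennreal ((cmod (f z))\<^sup>2 * bdist \<Omega> z powr (-\<alpha>)) \<partial>lborel) < \<infinity>}"

fun C_class :: "nat \<Rightarrow> ('a::euclidean_space \<Rightarrow> real) \<Rightarrow> bool" where
  "C_class 0 f \<longleftrightarrow> continuous_on UNIV f"
| "C_class (Suc k) f \<longleftrightarrow>
     (\<forall>x. f differentiable (at x)) \<and>
     (\<forall>b\<in>Basis. C_class k (\<lambda>x. frechet_derivative f (at x) b))"

text \<open>\<open>C\<^sub>0\<^sup>\<infinity>(\<Omega>)\<close>; its members are extended by zero to the whole space.\<close>

definition test_functions :: "'a::euclidean_space set \<Rightarrow> ('a \<Rightarrow> real) set" where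
  "test_functions \<Omega> =
     {\<phi>. (\<forall>k. C_class k \<phi>) \<and> compact (closure {x. \<phi> x \<noteq> 0}) \<and> closure {x. \<phi> x \<noteq> 0} \<subseteq> \<Omega>}"

text \<open>On \<open>complex ^ 'n\<close> the basis consists of the vectors \<open>e\<^sub>j\<close> and \<open>\<i> e\<^sub>j\<close>, so this is the gradient
  with respect to the \<open>2n\<close> real coordinates.\<close>

definition grad_sq :: "('a::euclidean_space \<Rightarrow> real) \<Rightarrow> 'a \<Rightarrow> real" where
  "grad_sq \<phi> x = (\<Sum>b\<in>Basis. (frechet_derivative \<phi> (at x) b)\<^sup>2)"

definition capacity :: "'a::euclidean_space set \<Rightarrow> 'a set \<Rightarrow> ennreal" where
  "capacity M \<Omega> =
     (INF \<phi> \<in> {\<phi> \<in> test_functions \<Omega>. (\<forall>x. 0 \<le> \<phi> x \<and> \<phi> x \<le> 1) \<and>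
                 (\<exists>U. open U \<and> M \<subseteq> U \<and> (\<forall>x\<in>U. \<phi> x = 1))}.
        \<integral>\<^sup>+x\<in>\<Omega>. ennreal (grad_sq \<phi> x) \<partial>lborel)"

end

(*
  If phi is a cutoff with compact support in Omega and g is smooth, integrating the
  d-bar derivative of phi h g in one coordinate z_k gives
    integral phi h (d-bar_k g) = - integral h g (d-bar_k phi).
  When the right-hand side can be made to tend to 0 while phi tends to 1, the left-hand side
  shows that h is orthogonal on Omega to every d-bar_k g, hence to all real exponentials, which
  have explicit d-bar_k primitives.  By Stone-Weierstrass h vanishes.

  Part (1) applies this to h = f^2, whose L^1 norm is the squared L^2 norm of f, with phi a truncation of
  log log(1/delta): no information on the size of {delta < t} is needed.  Part (2) applies it to
  h = f with the cutoffs that nearly attain the capacity, where f is small in L^2 on the support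
  of grad phi.  A negative alpha reduces to alpha = 0, where the constant function 1 would have to
  vanish, so that the hypothesis cannot hold.

  Only difference quotients in the two real directions of z_k are used.  The cutoff in (1) is
  merely Lipschitz, and the translation invariance of Lebesgue measure replaces Fubini.
*)
theory Submission
  imports Defs "HOL-Complex_Analysis.Cauchy_Integral_Formula"
begin

section \<open>Difference quotients under the integral\<close>

text \<open>Orthogonality to every d-bar_k g says that h, extended by zero, is weakly annihilated by
  d-bar_k on the whole space, and a compactly supported function with that property must vanish.
  Real exponentials make this elementary: the Laplace transform of the extension is zero at every
  real frequency, so neither regularity theory nor boundary values of h enter.

  The flux, the integral of |h| |grad phi|, is linear in |h|, and this dictates the choice of h. In
  (1) a Cauchy-Schwarz split would require control of the Dirichlet energy of phi, which a general
  boundary does not give. For h = f^2 the weight in the hypothesis is, up to constants, the size of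
  the gradient of log log(1/delta); since log log is unbounded, it can be divided by a large N
  before truncation, which leaves a factor 1/N in the flux. In (2) the energy is precisely what is
  known, so f itself is paired with grad phi: for alpha \<ge> 0 the integral of |f|^2 over {delta
  \<le> eps} is o(eps^alpha), the energy is O(eps^-alpha), and the product tends to 0.\<close>

lemma lborel_integral_shift:
  fixes f :: "'a::euclidean_space \<Rightarrow> 'b::{banach, second_countable_topology}"
  assumes "f \<in> borel_measurable borel"
  shows "(LINT x|lborel. f (a + x)) = (LINT x|lborel. f x)"
  using integral_distr[of "(+) a" lborel borel f] assms by (simp add: lborel_distr_plus)

lemma lborel_integrable_shift:
  fixes f :: "'a::euclidean_space \<Rightarrow> 'b::{banach, second_countable_topology}"
  assumes "f \<in> borel_measurable borel" "integrable lborel f"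
  shows "integrable lborel (\<lambda>x. f (a + x))"
  using integrable_distr_eq[of "(+) a" lborel borel f] assms by (simp add: lborel_distr_plus)

text \<open>Integration by parts along \<open>v\<close> by translation: the backward quotient of
  \<open>G\<close> against \<open>\<phi>\<close> has the same integral as minus the forward quotient
  of \<open>\<phi>\<close> against \<open>G\<close>, and the latter is dominated by
  \<open>norm (G x) * \<kappa> x\<close>. The Lipschitz bound on \<open>K\<close> then allows the
  step to tend to 0 on the side of \<open>G\<close>, while \<open>\<phi>\<close> is never
  differentiated.\<close>

lemma directional_derivative_pairing:
  fixes \<Omega> :: "'a::euclidean_space set" and \<phi> :: "'a \<Rightarrow> real" and G G' :: "'a \<Rightarrow> complex"
  assumes \<Omega>: "open \<Omega>" and G: "continuous_on \<Omega> G"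
    and K: "compact K" "K \<subseteq> \<Omega>" and \<phi>: "continuous_on UNIV \<phi>" "\<And>x. x \<notin> K \<Longrightarrow> \<phi> x = 0"
    and r: "r > 0"
    and L: "\<And>x t. x \<in> K \<Longrightarrow> \<bar>t\<bar> < r \<Longrightarrow>
              x + t *\<^sub>R v \<in> \<Omega> \<and> norm (G (x + t *\<^sub>R v) - G x) \<le> L * \<bar>t\<bar>"
    and G': "\<And>x. x \<in> K \<Longrightarrow> ((\<lambda>t. (G (x + t *\<^sub>R v) - G x) /\<^sub>R t) \<longlongrightarrow> G' x) (at 0)"
    and \<kappa>: "\<And>x t. x \<in> \<Omega> \<Longrightarrow> 0 < t \<Longrightarrow> t < r \<Longrightarrow> \<bar>\<phi> (x + t *\<^sub>R v) - \<phi> x\<bar> \<le> t * \<kappa> x"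
    and m: "(\<integral>\<^sup>+x\<in>\<Omega>. ennreal (norm (G x) * \<kappa> x) \<partial>lborel) \<le> ennreal m" "0 \<le> m"
  shows "integrable lborel (\<lambda>x. \<phi> x *\<^sub>R G' x)"
    and "norm (LINT x|lborel. \<phi> x *\<^sub>R G' x) \<le> m"
proof -
  define H where "H x = indicator \<Omega> x *\<^sub>R G x" for x
  have Hb[measurable]: "H \<in> borel_measurable borel"
    unfolding H_def using \<Omega> G by (intro borel_measurable_continuous_on_indicator) auto
  have \<phi>b[measurable]: "\<phi> \<in> borel_measurable borel"
    using \<phi>(1) by (rule borel_measurable_continuous_onI)
  have [measurable]: "K \<in> sets borel" using K by (simp add: borel_compact)
  have Kfin: "emeasure lborel K < \<infinity>" using K(1) by (rule emeasure_compact_finite)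
  have "compact (\<phi> ` K)" "compact (G ` K)"
    using \<phi>(1) G K continuous_on_subset by (blast intro: compact_continuous_image)+
  then obtain B1 B2 where B1: "\<And>x. x \<in> K \<Longrightarrow> norm (\<phi> x) \<le> B1" and B2: "\<And>x. x \<in> K \<Longrightarrow> norm (G x) \<le> B2"
    by (force simp: bounded_iff dest!: compact_imp_bounded)
  define P where "P t x = \<phi> x *\<^sub>R H (x - t *\<^sub>R v)" for t x
  have Pb[measurable]: "P t \<in> borel_measurable borel" for t unfolding P_def by measurable
  have HK: "H (x - t *\<^sub>R v) = G (x - t *\<^sub>R v)" "norm (G (x - t *\<^sub>R v) - G x) \<le> L * \<bar>t\<bar>"
    if "x \<in> K" "\<bar>t\<bar> < r" for x t
    using L[OF that(1), of "-t"] that by (auto simp: H_def)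
  have Pint: "integrable lborel (P t)" if t: "\<bar>t\<bar> < r" for t
  proof (rule integrableI_bounded_set[where A = K and B = "B1 * (B2 + L * \<bar>t\<bar>)"])
    have "norm (P t x) \<le> B1 * (B2 + L * \<bar>t\<bar>)" if "x \<in> K" for x
    proof -
      have "norm (G (x - t *\<^sub>R v)) \<le> norm (G x) + norm (G (x - t *\<^sub>R v) - G x)"
        by (metis add.commute diff_add_cancel norm_triangle_ineq)
      also have "\<dots> \<le> B2 + L * \<bar>t\<bar>" using HK(2)[OF that t] B2[OF that] by simp
      finally show ?thesis unfolding P_def HK(1)[OF that t] norm_scaleR
        using B1[OF that] by (intro mult_mono) (auto intro: order_trans[OF norm_ge_zero])
    qed
    then show "AE x in lborel. x \<in> K \<longrightarrow> norm (P t x) \<le> B1 * (B2 + L * \<bar>t\<bar>)" by simp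
  qed (use Kfin \<phi>(2) in \<open>auto simp: P_def\<close>)
  \<comment> \<open>With \<open>n + 2\<close> every step, including \<open>t 0\<close>, is strictly
    below \<open>r\<close>.\<close>
  define t where "t n = r / (real n + 2)" for n :: nat
  have t: "0 < t n" "t n < r" for n using r by (auto simp: t_def field_simps add_pos_nonneg)
  have t0: "t \<longlonglongrightarrow> 0" unfolding t_def by (rule real_tendsto_divide_at_top[OF tendsto_const])
      (rule filterlim_at_top_mono[OF filterlim_real_sequentially], simp)
  \<comment> \<open>Backward quotients of \<open>G\<close>, because the translation then moves the
    increment to \<open>\<phi>\<close> with a positive step, the only sign for which
    \<open>\<kappa>\<close> gives a bound.\<close>
  define D where "D n x = (P 0 x - P (t n) x) /\<^sub>R t n" for n x
  have Dn: "D n x = \<phi> x *\<^sub>R ((G (x + (- t n) *\<^sub>R v) - G x) /\<^sub>R (- t n))" if "x \<in> K" for n x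
    using HK(1)[OF that, of 0] HK(1)[OF that, of "t n"] t[of n] r
    by (simp add: D_def P_def scaleR_diff_right algebra_simps)
  have Dlim: "(\<lambda>n. D n x) \<longlonglongrightarrow> \<phi> x *\<^sub>R G' x" for x
  proof (cases "x \<in> K")
    case True
    have "filterlim (\<lambda>n. - t n) (at 0) sequentially"
      using tendsto_minus[OF t0] t(1) by (auto simp: filterlim_at intro!: always_eventually) (metis less_irrefl)
    from filterlim_compose[OF G'[OF True] this] show ?thesis
      unfolding Dn[OF True] by (intro tendsto_intros)
  qed (simp add: D_def P_def \<phi>(2))
  have Dbd: "norm (D n x) \<le> indicator K x * (B1 * L)" for n x
  proof (cases "x \<in> K")
    case True
    have "norm (G (x + (- t n) *\<^sub>R v) - G x) \<le> L * t n"
      using L[OF True, of "- t n"] t[of n] by auto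
    then have "norm ((G (x + (- t n) *\<^sub>R v) - G x) /\<^sub>R (- t n)) \<le> L"
      using t(1)[of n] by (simp only: norm_scaleR) (simp add: pos_divide_le_eq divide_inverse_commute[symmetric] mult.commute)
    then show ?thesis using True B1[OF True] unfolding Dn[OF True] norm_scaleR
      by (auto intro!: mult_mono intro: order_trans[OF abs_ge_zero])
  qed (simp add: D_def P_def \<phi>(2))
  have lim_meas: "(\<lambda>x. \<phi> x *\<^sub>R G' x) \<in> borel_measurable lborel"
    by (rule borel_measurable_LIMSEQ_metric[where f = D])
       (use Dlim in \<open>auto simp: D_def[abs_def]\<close>)
  have w: "integrable lborel (\<lambda>x. indicator K x * (B1 * L))"
    using Kfin by (intro integrable_mult_left integrable_real_indicator) auto
  show "integrable lborel (\<lambda>x. \<phi> x *\<^sub>R G' x)"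
    by (rule integrable_dominated_convergence[OF lim_meas _ w, of D])
       (use Dlim Dbd in \<open>auto simp: D_def[abs_def]\<close>)
  have lim: "(\<lambda>n. LINT x|lborel. D n x) \<longlonglongrightarrow> (LINT x|lborel. \<phi> x *\<^sub>R G' x)"
    by (rule integral_dominated_convergence[OF lim_meas _ w, of D])
       (use Dlim Dbd in \<open>auto simp: D_def[abs_def]\<close>)
  have "norm (LINT x|lborel. D n x) \<le> m" for n
  proof -
    \<comment> \<open>After the translation \<open>H\<close> sits at the unshifted point, so its
      zero extension confines the integrand to \<open>\<Omega>\<close>, where
      \<open>\<kappa>\<close> controls the increments of \<open>\<phi>\<close>.\<close>
    define Q where "Q x = ((\<phi> x - \<phi> (t n *\<^sub>R v + x)) / t n) *\<^sub>R H x" for x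
    have sh: "P (t n) (t n *\<^sub>R v + x) = \<phi> (t n *\<^sub>R v + x) *\<^sub>R H x" for x by (simp add: P_def)
    have i1: "integrable lborel (\<lambda>x. P 0 x)" using Pint[of 0] r by simp
    have i2: "integrable lborel (P (t n))" using Pint[of "t n"] t[of n] by simp
    have i3: "integrable lborel (\<lambda>x. \<phi> (t n *\<^sub>R v + x) *\<^sub>R H x)"
      using lborel_integrable_shift[OF Pb i2, of "t n *\<^sub>R v"] by (simp only: sh)
    have Qeq: "Q x = (P 0 x - \<phi> (t n *\<^sub>R v + x) *\<^sub>R H x) /\<^sub>R t n" for x
      by (simp add: Q_def P_def divide_inverse algebra_simps)
    have Qi: "integrable lborel Q" unfolding Qeq[abs_def] using i1 i3 by auto
    have "(LINT x|lborel. D n x) = ((LINT x|lborel. P 0 x) - (LINT x|lborel. P (t n) x)) /\<^sub>R t n"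
      unfolding D_def using i1 i2 by simp
    also have "(LINT x|lborel. P (t n) x) = (LINT x|lborel. \<phi> (t n *\<^sub>R v + x) *\<^sub>R H x)"
      using lborel_integral_shift[OF Pb, where a = "t n *\<^sub>R v" and t1 = "t n"] by (simp only: sh)
    also have "((LINT x|lborel. P 0 x) - \<dots>) /\<^sub>R t n = (LINT x|lborel. Q x)"
      unfolding Qeq using i1 i3 by simp
    finally have "ennreal (norm (LINT x|lborel. D n x)) = norm (LINT x|lborel. Q x)" by simp
    also have "\<dots> \<le> (\<integral>\<^sup>+x. norm (Q x) \<partial>lborel)" using Qi by (rule integral_norm_bound_ennreal)
    also have "\<dots> \<le> (\<integral>\<^sup>+x\<in>\<Omega>. ennreal (norm (G x) * \<kappa> x) \<partial>lborel)"
    proof (rule nn_integral_mono)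
      fix x
      show "ennreal (norm (Q x)) \<le> ennreal (norm (G x) * \<kappa> x) * indicator \<Omega> x"
      proof (cases "x \<in> \<Omega>")
        case True
        have "\<bar>\<phi> x - \<phi> (t n *\<^sub>R v + x)\<bar> / t n \<le> \<kappa> x"
          using \<kappa>[OF True, of "t n"] t[of n] by (simp add: field_simps abs_minus_commute)
        moreover have "norm (Q x) = \<bar>\<phi> x - \<phi> (t n *\<^sub>R v + x)\<bar> / t n * norm (G x)"
          using t(1)[of n] True by (simp add: Q_def H_def)
        ultimately have "norm (Q x) \<le> \<kappa> x * norm (G x)"
          by (metis mult_right_mono norm_ge_zero)
        then show ?thesis using True by (simp add: ennreal_leI mult.commute)
      qed (simp add: Q_def H_def)
    qed
    also note m(1)
    finally show ?thesis using m(2) by simp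
  qed
  then show "norm (LINT x|lborel. \<phi> x *\<^sub>R G' x) \<le> m"
    using tendsto_norm[OF lim] by (intro LIMSEQ_le_const2) auto
qed

section \<open>Holomorphic functions along coordinate discs\<close>

lemma axis_complex_eq: "axis k \<zeta> = \<zeta> *s axis k (1::complex)"
  by (simp add: vec_eq_iff axis_def)

lemma norm_axis_eq: "norm (axis k \<zeta>) = norm (\<zeta>::complex)"
  by (simp add: norm_eq_sqrt_inner inner_axis_axis)

lemma bounded_linear_axis: "bounded_linear (axis k :: complex \<Rightarrow> complex ^ 'n)"
proof (rule bounded_linear_intro[where K = 1])
  show "norm (axis k \<zeta> :: complex ^ 'n) \<le> norm \<zeta> * 1" for \<zeta> by (simp add: norm_axis_eq)
qed (auto simp: vec_eq_iff axis_def)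

lemma holomorphic_several_on_continuous:
  assumes "holomorphic_several_on f S"
  shows "continuous_on S f"
  using assms unfolding holomorphic_several_on_def
  by (meson continuous_at_imp_continuous_on has_derivative_continuous)

lemma holomorphic_several_on_slice:
  assumes "holomorphic_several_on f S"
  shows "(\<lambda>\<zeta>. f (x + axis k \<zeta>)) holomorphic_on {\<zeta>. x + axis k \<zeta> \<in> S}"
proof (rule holomorphic_onI)
  fix \<zeta> assume "\<zeta> \<in> {\<zeta>. x + axis k \<zeta> \<in> S}"
  then obtain D where D: "(f has_derivative D) (at (x + axis k \<zeta>))" "\<And>c v. D (c *s v) = c * D v"
    using assms unfolding holomorphic_several_on_def by blast
  have "((\<lambda>\<zeta>. x + axis k \<zeta>) has_derivative axis k) (at \<zeta>)"
    using bounded_linear.has_derivative[OF bounded_linear_axis has_derivative_ident]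
    by (auto intro!: derivative_eq_intros)
  note comp = has_derivative_compose[OF this D(1)]
  have "D (axis k w) = D (axis k 1) * w" for w
    using D(2)[of w "axis k 1"] axis_complex_eq[of k w] by (simp add: mult.commute)
  then have "(\<lambda>w. D (axis k w)) = (*) (D (axis k 1))" by blast
  with comp have "((\<lambda>\<zeta>. f (x + axis k \<zeta>)) has_field_derivative D (axis k 1)) (at \<zeta>)"
    by (simp only: has_field_derivative_def)
  then show "(\<lambda>\<zeta>. f (x + axis k \<zeta>)) field_differentiable at \<zeta> within {\<zeta>. x + axis k \<zeta> \<in> S}"
    using field_differentiable_at_within field_differentiable_def by blast
qed

text \<open>Cauchy's estimate on one-variable slices. A closed thickening of \<open>K\<close> is
  still a compact subset of \<open>S\<close>, so a single bound for \<open>f\<close> there gives a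
  constant uniform in \<open>x\<close>. This dominates the difference quotients of \<open>f\<close>
  in both real directions of coordinate \<open>k\<close>.\<close>

lemma holomorphic_several_on_slice_lipschitz:
  fixes f :: "complex ^ 'n \<Rightarrow> complex"
  assumes f: "holomorphic_several_on f S" and "open S" "compact K" "K \<subseteq> S"
  obtains r L where "r > 0" "L \<ge> 0"
    "\<And>x \<zeta>. x \<in> K \<Longrightarrow> norm \<zeta> < r \<Longrightarrow>
       x + axis k \<zeta> \<in> S \<and> norm (f (x + axis k \<zeta>) - f x) \<le> L * norm \<zeta>"
proof -
  obtain \<epsilon> where \<epsilon>: "\<epsilon> > 0" "(\<Union>x\<in>K. cball x \<epsilon>) \<subseteq> S"
    using compact_subset_open_imp_cball_epsilon_subset[OF assms(3,2,4)] by blast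
  define C where "C = {x + y | x y. x \<in> K \<and> y \<in> cball 0 \<epsilon>}"
  have "compact C" unfolding C_def using assms(3) by (intro compact_sums) auto
  moreover have inC: "x + axis k \<zeta> \<in> C" if "x \<in> K" "norm \<zeta> \<le> \<epsilon>" for x \<zeta>
    unfolding C_def mem_Collect_eq
    by (intro exI[of _ x] exI[of _ "axis k \<zeta>"]) (use that in \<open>auto simp: norm_axis_eq\<close>)
  moreover have CS: "C \<subseteq> S"
    using \<epsilon>(2) unfolding C_def by (force simp: dist_norm)
  ultimately have "compact (f ` C)"
    using holomorphic_several_on_continuous[OF f] by (blast intro: compact_continuous_image continuous_on_subset)
  then obtain M where M: "\<And>x. x \<in> C \<Longrightarrow> norm (f x) \<le> M" "M > 0"
    using bounded_pos[of "f ` C"] compact_imp_bounded by blast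
  \<comment> \<open>Half of the radius is reserved for the Cauchy discs: a closed disc of radius
    \<open>\<epsilon> / 2\<close> around a point of \<open>ball 0 (\<epsilon> / 2)\<close> stays in
    \<open>cball 0 \<epsilon>\<close>.\<close>
  have "norm (f (x + axis k \<zeta>) - f x) \<le> (M / (\<epsilon> / 2)) * norm \<zeta>" if x: "x \<in> K" and \<zeta>: "norm \<zeta> < \<epsilon> / 2" for x \<zeta>
  proof -
    define F where "F \<zeta> = f (x + axis k \<zeta>)" for \<zeta>
    have hol: "F holomorphic_on cball 0 \<epsilon>"
      unfolding F_def using inC[OF x] CS
      by (auto intro!: holomorphic_on_subset[OF holomorphic_several_on_slice[OF f]])
    have "norm (F \<zeta> - F 0) \<le> (M / (\<epsilon> / 2)) * norm (\<zeta> - 0)"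
    proof (rule field_differentiable_bound[of "ball 0 (\<epsilon> / 2)" F "deriv F"])
      fix w :: complex assume w: "w \<in> ball 0 (\<epsilon> / 2)"
      have "F holomorphic_on ball 0 \<epsilon>" using hol by (rule holomorphic_on_subset) auto
      with w \<epsilon>(1) have "(F has_field_derivative deriv F w) (at w)"
        by (intro holomorphic_derivI[of F "ball 0 \<epsilon>"]) auto
      then show "(F has_field_derivative deriv F w) (at w within ball 0 (\<epsilon> / 2))"
        by (rule has_field_derivative_at_within)
      have sub: "cball w (\<epsilon> / 2) \<subseteq> cball 0 \<epsilon>" using w by (auto simp: cball_subset_cball_iff)
      have "norm ((deriv ^^ 1) F w) \<le> fact 1 * M / (\<epsilon> / 2) ^ 1"
      proof (rule Cauchy_inequality)
        show "F holomorphic_on ball w (\<epsilon> / 2)" "continuous_on (cball w (\<epsilon> / 2)) F"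
          using hol sub ball_subset_cball holomorphic_on_imp_continuous_on holomorphic_on_subset by blast+
        fix z assume "norm (w - z) = \<epsilon> / 2"
        then have "z \<in> cball 0 \<epsilon>" using sub by (auto simp: dist_norm)
        then show "norm (F z) \<le> M" unfolding F_def using inC[OF x] M by auto
      qed (use \<epsilon> in auto)
      then show "norm (deriv F w) \<le> M / (\<epsilon> / 2)" by simp
    qed (use \<zeta> \<epsilon> in auto)
    then show ?thesis by (simp add: F_def axis_def zero_vec_def[symmetric])
  qed
  moreover have "x + axis k \<zeta> \<in> S" if "x \<in> K" "norm \<zeta> < \<epsilon> / 2" for x \<zeta>
    using inC[OF that(1), of \<zeta>] CS that \<epsilon>(1) by auto
  ultimately show ?thesis
    using that[of "\<epsilon> / 2" "M / (\<epsilon> / 2)"] \<epsilon>(1) M(2) by simp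
qed

section \<open>Cutoffs with small flux\<close>

lemma has_derivative_imp_directional_limit:
  assumes "(G has_derivative D) (at x)"
  shows "((\<lambda>t. (G (x + t *\<^sub>R v) - G x) /\<^sub>R t) \<longlongrightarrow> D v) (at 0)"
proof -
  have lin: "D (t *\<^sub>R v) = t *\<^sub>R D v" for t
    using assms by (simp add: has_derivative_def linear_simps(5))
  have line: "((\<lambda>t. x + t *\<^sub>R v) has_derivative (\<lambda>t. t *\<^sub>R v)) (at 0)"
    by (auto intro!: derivative_eq_intros)
  have "((\<lambda>t. G (x + t *\<^sub>R v)) has_derivative (\<lambda>t. t *\<^sub>R D v)) (at 0)"
    using has_derivative_compose[OF line, of G D] assms by (simp add: lin)
  then have "((\<lambda>t. norm (G (x + t *\<^sub>R v) - G x - t *\<^sub>R D v) / norm t) \<longlongrightarrow> 0) (at 0)"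
    by (simp add: has_derivative_at)
  then have "((\<lambda>t. norm ((G (x + t *\<^sub>R v) - G x) /\<^sub>R t - D v)) \<longlongrightarrow> 0) (at 0)"
  proof (rule Lim_transform_eventually)
    have "norm (w - t *\<^sub>R z) / norm t = norm (w /\<^sub>R t - z)" if "t \<noteq> 0" for t :: real and w z :: 'b
    proof -
      have "w /\<^sub>R t - z = (w - t *\<^sub>R z) /\<^sub>R t" using that by (simp add: scaleR_diff_right)
      then show ?thesis by (simp add: divide_inverse_commute)
    qed
    then show "\<forall>\<^sub>F t in at 0. norm (G (x + t *\<^sub>R v) - G x - t *\<^sub>R D v) / norm t =
        norm ((G (x + t *\<^sub>R v) - G x) /\<^sub>R t - D v)"
      by (auto simp: eventually_at_filter)
  qed
  then show ?thesis by (rule LIM_zero_cancel[OF tendsto_norm_zero_cancel])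
qed

text \<open>The bound \<open>\<kappa>\<close> on difference quotients plays the role of \<open>\<bar>\<nabla>\<phi>\<bar>\<close>,
  so that \<open>\<phi>\<close> need not be differentiable.\<close>

definition flux_cutoff :: "'a::euclidean_space set \<Rightarrow> ('a \<Rightarrow> complex) \<Rightarrow> real \<Rightarrow> ('a \<Rightarrow> real) \<Rightarrow> bool" where
  "flux_cutoff \<Omega> h m \<phi> \<longleftrightarrow>
     continuous_on UNIV \<phi> \<and> (\<forall>x. 0 \<le> \<phi> x \<and> \<phi> x \<le> 1) \<and>
     (\<exists>K. compact K \<and> K \<subseteq> \<Omega> \<and> (\<forall>x. x \<notin> K \<longrightarrow> \<phi> x = 0)) \<and>
     (\<forall>x\<in>\<Omega>. m \<le> infdist x (- \<Omega>) \<longrightarrow> \<phi> x = 1) \<and>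
     (\<exists>\<kappa> t\<^sub>0. t\<^sub>0 > 0 \<and>
        (\<forall>x\<in>\<Omega>. \<forall>v\<in>Basis. \<forall>t. 0 < t \<and> t < t\<^sub>0 \<longrightarrow> \<bar>\<phi> (x + t *\<^sub>R v) - \<phi> x\<bar> \<le> t * \<kappa> x) \<and>
        (\<integral>\<^sup>+x\<in>\<Omega>. ennreal (norm (h x) * \<kappa> x) \<partial>lborel) \<le> ennreal m)"

text \<open>The pairing is applied to the product \<open>h * g\<close> in the two real directions of
  coordinate \<open>k\<close>. The operator "derivative along 1 plus \<open>\<i>\<close> times
  derivative along \<open>\<i>\<close>" is twice d-bar_k; it annihilates \<open>h\<close>, so only
  the derivative of \<open>g\<close> survives. As \<open>norm (g x) \<le> 1\<close>, each direction
  contributes at most \<open>m\<close>.\<close>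

lemma flux_cutoff_pairing_bound:
  fixes \<Omega> :: "(complex ^ 'n) set"
  assumes \<Omega>: "open \<Omega>" and h: "holomorphic_several_on h \<Omega>"
    and g: "\<And>x. x \<in> \<Omega> \<Longrightarrow> (g has_derivative g' x) (at x)"
      "\<And>x y. x \<in> \<Omega> \<Longrightarrow> y \<in> \<Omega> \<Longrightarrow> norm (g x - g y) \<le> M * norm (x - y)" "M \<ge> 0"
      "\<And>x. x \<in> \<Omega> \<Longrightarrow> norm (g x) \<le> 1"
    and cut: "flux_cutoff \<Omega> h m \<phi>" "m \<ge> 0"
  shows "norm (LINT x|lborel. \<phi> x *\<^sub>R (h x * (g' x (axis k 1) + \<i> * g' x (axis k \<i>)))) \<le> 2 * m"
proof -
  from cut(1) obtain K where \<phi>: "continuous_on UNIV \<phi>" and K: "compact K" "K \<subseteq> \<Omega>"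
    and \<phi>0: "\<And>x. x \<notin> K \<Longrightarrow> \<phi> x = 0"
    unfolding flux_cutoff_def by (elim conjE exE) (rule that, auto)
  from cut(1) obtain \<kappa> t\<^sub>0 where t0: "t\<^sub>0 > 0"
    and \<kappa>: "\<And>x v t. x \<in> \<Omega> \<Longrightarrow> v \<in> Basis \<Longrightarrow> 0 < t \<Longrightarrow> t < t\<^sub>0 \<Longrightarrow> \<bar>\<phi> (x + t *\<^sub>R v) - \<phi> x\<bar> \<le> t * \<kappa> x"
    and int: "(\<integral>\<^sup>+x\<in>\<Omega>. ennreal (norm (h x) * \<kappa> x) \<partial>lborel) \<le> ennreal m"
    unfolding flux_cutoff_def by (elim conjE exE) (rule that, auto)
  obtain Dh where Dh: "\<And>z. z \<in> \<Omega> \<Longrightarrow> (h has_derivative Dh z) (at z)"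
      "\<And>z c v. z \<in> \<Omega> \<Longrightarrow> Dh z (c *s v) = c * Dh z v"
    using h unfolding holomorphic_several_on_def by metis
  obtain r L where rL: "r > 0" "L \<ge> 0" and L: "\<And>x \<zeta>. x \<in> K \<Longrightarrow> norm \<zeta> < r \<Longrightarrow>
       x + axis k \<zeta> \<in> \<Omega> \<and> norm (h (x + axis k \<zeta>) - h x) \<le> L * norm \<zeta>"
    using holomorphic_several_on_slice_lipschitz[OF h \<Omega> K] by blast
  have hc: "continuous_on \<Omega> h" using h by (rule holomorphic_several_on_continuous)
  have gc: "continuous_on \<Omega> g"
    using g(1) by (meson continuous_at_imp_continuous_on has_derivative_continuous)
  have "compact (h ` K)" using hc K by (blast intro: compact_continuous_image continuous_on_subset)
  then obtain Bh where Bh: "\<And>x. x \<in> K \<Longrightarrow> norm (h x) \<le> Bh" "Bh > 0"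
    using bounded_pos[of "h ` K"] compact_imp_bounded by blast
  define G' where "G' \<zeta> x = Dh x (axis k \<zeta>) * g x + h x * g' x (axis k \<zeta>)" for \<zeta> x
  have *: "integrable lborel (\<lambda>x. \<phi> x *\<^sub>R G' \<zeta> x) \<and> norm (LINT x|lborel. \<phi> x *\<^sub>R G' \<zeta> x) \<le> m"
    if \<zeta>: "\<zeta> \<in> Basis" for \<zeta> :: complex
  proof -
    have v: "axis k \<zeta> \<in> Basis" using \<zeta> by (simp add: axis_in_Basis_iff)
    have n: "norm \<zeta> = 1" using \<zeta> by simp
    have sc: "t *\<^sub>R axis k \<zeta> = axis k (t *\<^sub>R \<zeta>)" for t by (simp add: vec_eq_iff axis_def)
    have lip: "x + t *\<^sub>R axis k \<zeta> \<in> \<Omega> \<and> norm (h (x + t *\<^sub>R axis k \<zeta>) * g (x + t *\<^sub>R axis k \<zeta>) - h x * g x) \<le> (L + Bh * M) * \<bar>t\<bar>"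
      if x: "x \<in> K" and t: "\<bar>t\<bar> < min r t\<^sub>0" for x t
    proof -
      have y: "x + t *\<^sub>R axis k \<zeta> \<in> \<Omega>" "norm (h (x + t *\<^sub>R axis k \<zeta>) - h x) \<le> L * \<bar>t\<bar>"
        using L[OF x, of "t *\<^sub>R \<zeta>"] t n by (auto simp: sc)
      let ?y = "x + t *\<^sub>R axis k \<zeta>"
      have gy: "norm (g ?y - g x) \<le> M * \<bar>t\<bar>"
        using g(2)[of ?y x] y(1) x K(2) n by (auto simp: norm_axis_eq)
      have "h ?y * g ?y - h x * g x = (h ?y - h x) * g ?y + h x * (g ?y - g x)" by (simp add: algebra_simps)
      then have "norm (h ?y * g ?y - h x * g x) \<le> norm (h ?y - h x) * norm (g ?y) + norm (h x) * norm (g ?y - g x)"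
        by (metis norm_mult norm_triangle_ineq)
      also have "\<dots> \<le> (L * \<bar>t\<bar>) * 1 + Bh * (M * \<bar>t\<bar>)"
        using y gy g(4)[OF y(1)] Bh(1)[OF x] Bh(2) rL by (intro add_mono mult_mono) auto
      finally show ?thesis using y(1) by (simp add: algebra_simps)
    qed
    have lim: "((\<lambda>t. (h (x + t *\<^sub>R axis k \<zeta>) * g (x + t *\<^sub>R axis k \<zeta>) - h x * g x) /\<^sub>R t) \<longlongrightarrow> G' \<zeta> x) (at 0)"
      if "x \<in> K" for x
    proof -
      have "((\<lambda>x. h x * g x) has_derivative (\<lambda>v. h x * g' x v + Dh x v * g x)) (at x)"
        using Dh(1) g(1) that K by (intro has_derivative_mult) auto
      from has_derivative_imp_directional_limit[OF this, of "axis k \<zeta>"]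
      show ?thesis by (simp add: G'_def add.commute)
    qed
    have "(\<integral>\<^sup>+x\<in>\<Omega>. ennreal (norm (h x * g x) * \<kappa> x) \<partial>lborel) \<le> (\<integral>\<^sup>+x\<in>\<Omega>. ennreal (norm (h x) * \<kappa> x) \<partial>lborel)"
    proof (rule nn_integral_mono)
      fix x
      show "ennreal (norm (h x * g x) * \<kappa> x) * indicator \<Omega> x \<le> ennreal (norm (h x) * \<kappa> x) * indicator \<Omega> x"
      proof (cases "x \<in> \<Omega>")
        case True
        \<comment> \<open>The bound at one admissible step already forces
          \<open>\<kappa> x \<ge> 0\<close>, which allows the factor
          \<open>norm (g x) \<le> 1\<close> to be dropped.\<close>
        have "\<bar>\<phi> (x + (t\<^sub>0 / 2) *\<^sub>R axis k \<zeta>) - \<phi> x\<bar> \<le> (t\<^sub>0 / 2) * \<kappa> x"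
          using \<kappa>[OF True v, of "t\<^sub>0 / 2"] t0 by simp
        then have "0 \<le> (t\<^sub>0 / 2) * \<kappa> x" by linarith
        then have "0 \<le> \<kappa> x" using t0 by (simp add: zero_le_mult_iff)
        moreover have "norm (h x) * norm (g x) \<le> norm (h x) * 1"
          using g(4)[OF True] by (intro mult_left_mono) auto
        ultimately show ?thesis using True
          by (auto simp: norm_mult intro!: ennreal_leI mult_right_mono)
      qed simp
    qed
    with int have int': "(\<integral>\<^sup>+x\<in>\<Omega>. ennreal (norm (h x * g x) * \<kappa> x) \<partial>lborel) \<le> ennreal m" by simp
    have "min r t\<^sub>0 > 0" using rL t0 by simp
    note pairing = directional_derivative_pairing[OF \<Omega> continuous_on_mult[OF hc gc] K \<phi> \<phi>0 this lip lim _ int' cut(2)]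
    show ?thesis using pairing \<kappa>[OF _ v] by auto
  qed
  have B: "1 \<in> (Basis :: complex set)" "\<i> \<in> (Basis :: complex set)" by (auto simp: Basis_complex_def)
  have eq: "\<phi> x *\<^sub>R (h x * (g' x (axis k 1) + \<i> * g' x (axis k \<i>))) = \<phi> x *\<^sub>R G' 1 x + \<i> * (\<phi> x *\<^sub>R G' \<i> x)" for x
  proof (cases "x \<in> K")
    case True
    \<comment> \<open>Cauchy-Riemann: the terms containing \<open>Dh\<close> add up to
      \<open>(1 + \<i> * \<i>) * Dh x (axis k 1) * g x\<close>, which is 0.\<close>
    then have "Dh x (axis k \<i>) = \<i> * Dh x (axis k 1)"
      using Dh(2)[of x \<i> "axis k 1"] K axis_complex_eq[of k \<i>] by auto
    then show ?thesis by (simp add: G'_def scaleR_conv_of_real algebra_simps)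
  qed (simp add: \<phi>0)
  have "(LINT x|lborel. \<phi> x *\<^sub>R (h x * (g' x (axis k 1) + \<i> * g' x (axis k \<i>)))) =
      (LINT x|lborel. \<phi> x *\<^sub>R G' 1 x) + \<i> * (LINT x|lborel. \<phi> x *\<^sub>R G' \<i> x)"
    unfolding eq using *[OF B(1)] *[OF B(2)] by (simp del: mult_scaleR_right)
  also have "norm \<dots> \<le> m + m"
    using *[OF B(1)] *[OF B(2)] by (intro norm_triangle_mono) (auto simp: norm_mult)
  finally show ?thesis by simp
qed

text \<open>The one parameter \<open>m\<close> bounds both the flux and the width of the collar
  where \<open>\<phi>\<close> may differ from 1. Letting \<open>m\<close> tend to 0 therefore sends
  the pairing to 0 and \<open>\<phi>\<close> to 1 at every point of \<open>\<Omega>\<close>, with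
  \<open>norm (h x) * Q\<close> as dominating function.\<close>

lemma flux_cutoff_pairing_zero:
  fixes \<Omega> :: "(complex ^ 'n) set"
  assumes \<Omega>: "open \<Omega>" "bounded \<Omega>" and h: "holomorphic_several_on h \<Omega>" "set_integrable lborel \<Omega> h"
    and g: "\<And>x. x \<in> \<Omega> \<Longrightarrow> (g has_derivative g' x) (at x)"
      "\<And>x y. x \<in> \<Omega> \<Longrightarrow> y \<in> \<Omega> \<Longrightarrow> norm (g x - g y) \<le> M * norm (x - y)" "M \<ge> 0"
      "\<And>x. x \<in> \<Omega> \<Longrightarrow> norm (g x) \<le> 1"
    and q: "\<And>x. x \<in> \<Omega> \<Longrightarrow> g' x (axis k 1) + \<i> * g' x (axis k \<i>) = q x"
      "continuous_on \<Omega> q" "\<And>x. x \<in> \<Omega> \<Longrightarrow> norm (q x) \<le> Q"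
    and cut: "\<And>m. m > 0 \<Longrightarrow> \<exists>\<phi>. flux_cutoff \<Omega> h m \<phi>"
  shows "(LINT x:\<Omega>|lborel. h x * q x) = 0"
proof -
  define e where "e j = 1 / (real j + 1)" for j
  have e: "e j > 0" for j by (simp add: e_def add_nonneg_pos)
  have e0: "e \<longlonglongrightarrow> 0" unfolding e_def
    by (rule real_tendsto_divide_at_top[OF tendsto_const])
      (rule filterlim_at_top_mono[OF filterlim_real_sequentially], simp)
  have "\<exists>\<phi>. \<forall>j. flux_cutoff \<Omega> h (e j) (\<phi> j)" by (intro choice allI cut e)
  then obtain \<phi> where \<phi>: "\<And>j. flux_cutoff \<Omega> h (e j) (\<phi> j)" by blast
  have off: "\<phi> j x = 0" if "x \<notin> \<Omega>" for j x using \<phi>[of j] that unfolding flux_cutoff_def by blast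
  have r01: "0 \<le> \<phi> j x" "\<phi> j x \<le> 1" for j x using \<phi>[of j] unfolding flux_cutoff_def by blast+
  have \<phi>b[measurable]: "\<phi> j \<in> borel_measurable borel" for j
    using \<phi>[of j] unfolding flux_cutoff_def by (blast intro: borel_measurable_continuous_onI)
  have hc: "continuous_on \<Omega> h" using h(1) by (rule holomorphic_several_on_continuous)
  define s where "s j x = \<phi> j x *\<^sub>R (indicator \<Omega> x *\<^sub>R (h x * q x))" for j x
  have lim_meas[measurable]: "(\<lambda>x. indicator \<Omega> x *\<^sub>R (h x * q x)) \<in> borel_measurable lborel"
    using \<Omega> hc q(2) by (simp, intro borel_measurable_continuous_on_indicator continuous_intros) auto
  have sb: "s j \<in> borel_measurable lborel" for j
    unfolding s_def[abs_def] using \<phi>b by (intro borel_measurable_scaleR lim_meas) simp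
  have w: "integrable lborel (\<lambda>x. norm (indicator \<Omega> x *\<^sub>R h x) * Q)"
    using h(2) unfolding set_integrable_def by (intro integrable_mult_left integrable_norm)
  have bd: "norm (s j x) \<le> norm (indicator \<Omega> x *\<^sub>R h x) * Q" for j x
  proof (cases "x \<in> \<Omega>")
    case True
    have "\<bar>\<phi> j x\<bar> * (norm (h x) * norm (q x)) \<le> 1 * (norm (h x) * Q)"
      using r01[of j x] q(3)[OF True] by (intro mult_mono mult_left_mono) (auto intro!: mult_nonneg_nonneg intro: order_trans[OF norm_ge_zero])
    then show ?thesis using True by (simp add: s_def norm_mult)
  qed (simp add: s_def)
  have "(\<lambda>j. s j x) \<longlonglongrightarrow> indicator \<Omega> x *\<^sub>R (h x * q x)" for x
  proof (cases "x \<in> \<Omega>")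
    case True
    \<comment> \<open>\<open>infdist\<close> to the empty set is 0 by convention, so positivity
      requires a nonempty complement; boundedness of \<open>\<Omega>\<close> provides it.\<close>
    have "- \<Omega> \<noteq> {}" using \<Omega>(2) not_bounded_UNIV by (metis Compl_empty_eq double_complement)
    then have "infdist x (- \<Omega>) > 0"
      using True \<Omega>(1) by (intro infdist_pos_not_in_closed) (auto simp: closed_def)
    then have "\<forall>\<^sub>F j in sequentially. e j < infdist x (- \<Omega>)" using e0 by (rule order_tendstoD(2)[rotated])
    then have "\<forall>\<^sub>F j in sequentially. s j x = indicator \<Omega> x *\<^sub>R (h x * q x)"
    proof eventually_elim
      case (elim j)
      then have "\<phi> j x = 1" using \<phi>[of j] True unfolding flux_cutoff_def by auto
      then show ?case by (simp add: s_def)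
    qed
    then show ?thesis by (rule tendsto_eventually)
  qed (simp add: s_def)
  then have lim: "(\<lambda>j. LINT x|lborel. s j x) \<longlonglongrightarrow> (LINT x|lborel. indicator \<Omega> x *\<^sub>R (h x * q x))"
    by (intro integral_dominated_convergence[OF lim_meas sb w]) (use bd in auto)
  have "norm (LINT x|lborel. s j x) \<le> 2 * e j" for j
  proof -
    have "s j = (\<lambda>x. \<phi> j x *\<^sub>R (h x * (g' x (axis k 1) + \<i> * g' x (axis k \<i>))))"
    proof
      fix x show "s j x = \<phi> j x *\<^sub>R (h x * (g' x (axis k 1) + \<i> * g' x (axis k \<i>)))"
        by (cases "x \<in> \<Omega>") (auto simp: s_def q off)
    qed
    then show ?thesis
      using flux_cutoff_pairing_bound[OF \<Omega>(1) h(1) g \<phi>[of j], where k = k] e[of j] by simp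
  qed
  then have "norm (LINT x|lborel. indicator \<Omega> x *\<^sub>R (h x * q x)) \<le> 2 * 0"
    by (intro LIMSEQ_le[OF tendsto_norm[OF lim] tendsto_mult_left[OF e0, of 2]]) auto
  then show ?thesis by (simp add: set_lebesgue_integral_def)
qed

section \<open>Density of real exponentials\<close>

text \<open>The algebra fed to Stone-Weierstrass. With the coefficient built into
  \<open>single\<close>, the constants are the case \<open>\<xi> = 0\<close>.\<close>

inductive exponential_sum :: "('a::euclidean_space \<Rightarrow> real) \<Rightarrow> bool" where
  single: "exponential_sum (\<lambda>x. c * exp (\<xi> \<bullet> x))"
| add: "exponential_sum f \<Longrightarrow> exponential_sum g \<Longrightarrow> exponential_sum (\<lambda>x. f x + g x)"

lemma exponential_sum_continuous: "exponential_sum f \<Longrightarrow> continuous_on S f"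
  by (induction rule: exponential_sum.induct) (auto intro!: continuous_intros)

lemma exponential_sum_mult:
  assumes "exponential_sum f" "exponential_sum g"
  shows "exponential_sum (\<lambda>x. f x * g x)"
  using assms
proof (induction rule: exponential_sum.induct)
  case (single c \<xi>)
  from single show ?case
  proof (induction rule: exponential_sum.induct)
    case (single d \<eta>)
    have "(\<lambda>x. c * exp (\<xi> \<bullet> x) * (d * exp (\<eta> \<bullet> x))) = (\<lambda>x. (c * d) * exp ((\<xi> + \<eta>) \<bullet> x))"
      by (auto simp: inner_add_left exp_add)
    then show ?case using exponential_sum.single by metis
  next
    case (add f g)
    then show ?case using exponential_sum.add by (simp add: distrib_left)
  qed
next
  case (add f1 f2)
  then show ?case using exponential_sum.add by (simp add: distrib_right)
qed

section \<open>Moments of a compactly supported integrable function\<close>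

lemma integrable_mult_continuous:
  fixes H :: "'a::euclidean_space \<Rightarrow> complex" and u :: "'a \<Rightarrow> real"
  assumes H: "integrable lborel H" "compact S" "\<And>x. x \<notin> S \<Longrightarrow> H x = 0" and u: "continuous_on UNIV u"
  shows "integrable lborel (\<lambda>x. H x * of_real (u x))"
proof -
  have "compact (u ` S)" using u H(2) by (blast intro: compact_continuous_image continuous_on_subset)
  then obtain B where B: "B > 0" "\<And>x. x \<in> S \<Longrightarrow> norm (u x) \<le> B"
    using bounded_pos[of "u ` S"] compact_imp_bounded by blast
  have [measurable]: "u \<in> borel_measurable borel" using u by (rule borel_measurable_continuous_onI)
  have [measurable]: "H \<in> borel_measurable borel" using H(1) by auto
  show ?thesis
  proof (rule Bochner_Integration.integrable_bound[OF integrable_mult_left[OF H(1), of "of_real B"]])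
    have "norm (H x) * norm (u x) \<le> norm (H x) * B" for x
      using B H(3)[of x] by (cases "x \<in> S") (auto intro: mult_left_mono)
    then show "AE x in lborel. norm (H x * of_real (u x)) \<le> norm (H x * of_real B)"
      using B(1) by (auto simp: norm_mult)
  qed simp
qed

text \<open>Exponential sums are uniformly dense in the continuous functions on the compact set
  \<open>S\<close>, and a uniform error in \<open>u\<close> changes the moment by at most that error
  times the L^1 norm of \<open>H\<close>.\<close>

lemma exponential_moments_zero:
  fixes H :: "'a::euclidean_space \<Rightarrow> complex" and u :: "'a \<Rightarrow> real"
  assumes H: "integrable lborel H" "compact S" "\<And>x. x \<notin> S \<Longrightarrow> H x = 0"
    and exp: "\<And>\<xi>. (LINT x|lborel. H x * of_real (exp (\<xi> \<bullet> x))) = 0"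
    and u: "continuous_on UNIV u"
  shows "(LINT x|lborel. H x * of_real (u x)) = 0"
proof -
  have int: "integrable lborel (\<lambda>x. H x * of_real (u x))" if "continuous_on UNIV u" for u
    using integrable_mult_continuous[OF H that] by simp
  have es: "(LINT x|lborel. H x * of_real (f x)) = 0" if "exponential_sum f" for f
    using that
  proof induction
    case (single c \<xi>)
    have "(LINT x|lborel. H x * of_real (c * exp (\<xi> \<bullet> x))) = (LINT x|lborel. of_real c * (H x * of_real (exp (\<xi> \<bullet> x))))"
      by (simp add: mult_ac)
    also have "\<dots> = 0" by (subst integral_mult_right_zero) (simp only: exp mult_zero_right)
    finally show ?case .
  next
    case (add f g)
    then show ?case
      using int[OF exponential_sum_continuous, of f] int[OF exponential_sum_continuous, of g]
      by (simp add: distrib_left)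
  qed
  interpret function_ring_on "Collect exponential_sum" S
  proof
    show "(\<lambda>_. c) \<in> Collect exponential_sum" for c using exponential_sum.single[of c 0] by simp
    show "\<exists>f\<in>Collect exponential_sum. f x \<noteq> f y" if "x \<noteq> y" for x y :: 'a
    proof -
      \<comment> \<open>The frequency \<open>x - y\<close> separates the two points, since the
        difference of the inner products is the squared norm of \<open>x - y\<close>.\<close>
      have "(x - y) \<bullet> x \<noteq> (x - y) \<bullet> y"
        using that by (metis eq_iff_diff_eq_0 inner_diff_right inner_eq_zero_iff)
      then show ?thesis using exponential_sum.single[of 1 "x - y"] by (intro bexI) auto
    qed
  qed (use H(2) exponential_sum_continuous exponential_sum_mult exponential_sum.add in auto)
  have "norm (LINT x|lborel. H x * of_real (u x)) \<le> 0 + e" if e: "e > 0" for e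
  proof -
    define I where "I = (LINT x|lborel. norm (H x))"
    have I: "I \<ge> 0" unfolding I_def by simp
    \<comment> \<open>The summand 1 covers the case \<open>I = 0\<close>.\<close>
    have "e / (I + 1) > 0" using e I by simp
    from Stone_Weierstrass_basic[OF continuous_on_subset[OF u] this]
    obtain f where f: "exponential_sum f" "\<And>x. x \<in> S \<Longrightarrow> \<bar>u x - f x\<bar> < e / (I + 1)" by auto
    have i: "integrable lborel (\<lambda>x. H x * of_real (u x - f x))"
      using u exponential_sum_continuous[OF f(1)] by (intro int continuous_intros)
    have "(LINT x|lborel. H x * of_real (u x)) = (LINT x|lborel. H x * of_real (u x - f x))"
      using es[OF f(1)] int[OF u] int[OF exponential_sum_continuous[OF f(1)]] by (simp add: algebra_simps)
    also have "norm \<dots> \<le> (LINT x|lborel. norm (H x) * (e / (I + 1)))"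
    proof (rule Bochner_Integration.integral_norm_bound_integral[OF i])
      show "norm (H x * of_real (u x - f x)) \<le> norm (H x) * (e / (I + 1))" for x
        using mult_left_mono[OF less_imp_le[OF f(2)[of x]] norm_ge_zero[of "H x"]] H(3)[of x]
        by (cases "x \<in> S") (auto simp: norm_mult simp del: of_real_diff)
    qed (use H(1) in auto)
    also have "\<dots> = I * (e / (I + 1))" by (simp add: I_def)
    also have "\<dots> \<le> e" using I e by (simp add: field_simps)
    finally show ?thesis by simp
  qed
  then have "norm (LINT x|lborel. H x * of_real (u x)) \<le> 0" by (rule field_le_epsilon)
  then show ?thesis by simp
qed

text \<open>If \<open>h a\<close> were nonzero, a tent function centred at \<open>a\<close> with
  small support would give a moment differing from \<open>h a\<close> times the mass of the tent by
  at most half of that quantity, so the moment could not be 0.\<close>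

lemma continuous_moments_zero_imp_zero:
  fixes \<Omega> :: "'a::euclidean_space set" and h :: "'a \<Rightarrow> complex"
  assumes \<Omega>: "open \<Omega>" and h: "continuous_on \<Omega> h"
    and zero: "\<And>u :: 'a \<Rightarrow> real. continuous_on UNIV u \<Longrightarrow>
                 (LINT x|lborel. (indicator \<Omega> x *\<^sub>R h x) * of_real (u x)) = 0"
    and int: "integrable lborel (\<lambda>x. indicator \<Omega> x *\<^sub>R h x)"
    and a: "a \<in> \<Omega>"
  shows "h a = 0"
proof (rule ccontr)
  assume "h a \<noteq> 0"
  then have pos: "norm (h a) / 2 > 0" by simp
  have "isCont h a" using h \<Omega> a continuous_on_eq_continuous_at by blast
  then obtain s where s: "s > 0" "\<And>x. dist x a < s \<Longrightarrow> dist (h x) (h a) < norm (h a) / 2"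
    using pos unfolding continuous_at_eps_delta by blast
  obtain t where t: "t > 0" "ball a t \<subseteq> \<Omega>" using \<Omega> a open_contains_ball by blast
  define r where "r = min s t"
  have r: "r > 0" using s t by (simp add: r_def)
  define u where "u x = max 0 (r - dist x a)" for x
  have u: "continuous_on UNIV u" unfolding u_def by (intro continuous_intros)
  have u0: "u x \<ge> 0" for x by (simp add: u_def)
  have [measurable]: "u \<in> borel_measurable borel" using u by (rule borel_measurable_continuous_onI)
  have fin: "emeasure lborel (ball a c) < \<infinity>" for c by (rule emeasure_bounded_finite) simp
  have ui: "integrable lborel u"
    by (rule integrableI_bounded_set[where A = "ball a r" and B = r])
      (use r in \<open>auto simp: u_def dist_commute fin[unfolded infinity_ennreal_def]\<close>)
  have near: "norm ((h a - indicator \<Omega> x *\<^sub>R h x) * of_real (u x)) \<le> norm (h a) / 2 * u x" for x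
  proof (cases "dist x a < r")
    case True
    then have "x \<in> \<Omega>" "dist (h x) (h a) < norm (h a) / 2"
      using s(2)[of x] t(2) by (auto simp: r_def dist_commute[of a])
    then have "norm (h a - h x) * u x \<le> norm (h a) / 2 * u x"
      using u0[of x] by (intro mult_right_mono) (auto simp: dist_norm norm_minus_commute)
    then show ?thesis using \<open>x \<in> \<Omega>\<close> u0[of x] by (simp add: norm_mult)
  qed (simp add: u_def)
  let ?V = "LINT x|lborel. u x"
  have uci: "integrable lborel (\<lambda>x. h a * of_real (u x))" using ui by auto
  have Hui: "integrable lborel (\<lambda>x. (h a - indicator \<Omega> x *\<^sub>R h x) * of_real (u x))"
  proof (rule Bochner_Integration.integrable_bound[of _ "\<lambda>x. norm (h a) / 2 * u x"])
    have "(\<lambda>x. indicator \<Omega> x *\<^sub>R h x) \<in> borel_measurable lborel" using int by (rule borel_measurable_integrable)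
    then show "(\<lambda>x. (h a - indicator \<Omega> x *\<^sub>R h x) * of_real (u x)) \<in> borel_measurable lborel"
      by (intro borel_measurable_times borel_measurable_diff) auto
  qed (use ui near u0 in auto)
  have "(LINT x|lborel. (h a - indicator \<Omega> x *\<^sub>R h x) * of_real (u x)) =
      (LINT x|lborel. h a * of_real (u x)) -
      (LINT x|lborel. h a * of_real (u x) - (h a - indicator \<Omega> x *\<^sub>R h x) * of_real (u x))"
    using Bochner_Integration.integral_diff[OF uci Hui] by simp
  also have "(LINT x|lborel. h a * of_real (u x) - (h a - indicator \<Omega> x *\<^sub>R h x) * of_real (u x)) = 0"
    using zero[OF u] by (simp add: algebra_simps)
  finally have "norm (h a * of_real ?V) \<le> (LINT x|lborel. norm (h a) / 2 * u x)"
    using Bochner_Integration.integral_norm_bound_integral[OF Hui _ near] ui by simp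
  then have "norm (h a) * ?V \<le> norm (h a) / 2 * ?V"
    using u0 by (simp add: norm_mult)
  moreover have "?V > 0"
  proof -
    \<comment> \<open>The tent is at least \<open>r / 2\<close> on the ball of half its
      radius.\<close>
    have "0 < measure lborel (ball a (r / 2)) * (r / 2)" using r by (simp add: content_ball_pos)
    also have "\<dots> = (LINT x|lborel. indicator (ball a (r / 2)) x * (r / 2))" by simp
    also have "\<dots> \<le> ?V"
    proof (rule integral_mono[OF _ ui])
      show "integrable lborel (\<lambda>x. indicator (ball a (r / 2)) x * (r / 2))"
        by (intro integrable_mult_left integrable_real_indicator) (auto simp: fin[unfolded infinity_ennreal_def])
      show "indicator (ball a (r / 2)) x * (r / 2) \<le> u x" for x
        by (auto simp: u_def dist_commute max_def split: split_indicator)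
    qed
    finally show ?thesis .
  qed
  ultimately have "norm (h a) \<le> norm (h a) / 2" using mult_le_cancel_right_pos by blast
  then show False using pos by simp
qed

text \<open>Rescaling \<open>g\<close> removes the normalisation \<open>\<bar>g\<bar> \<le> 1\<close>.\<close>

lemma flux_cutoff_pairing_zero_C1:
  fixes \<Omega> :: "(complex ^ 'n) set" and g :: "complex ^ 'n \<Rightarrow> complex"
  assumes \<Omega>: "open \<Omega>" "bounded \<Omega>" and h: "holomorphic_several_on h \<Omega>" "set_integrable lborel \<Omega> h"
    and cut: "\<And>m. m > 0 \<Longrightarrow> \<exists>\<phi>. flux_cutoff \<Omega> h m \<phi>"
    and g: "\<And>x. (g has_derivative g' x) (at x)" "\<And>v. continuous_on UNIV (\<lambda>x. g' x v)"
  shows "(LINT x:\<Omega>|lborel. h x * (g' x (axis k 1) + \<i> * g' x (axis k \<i>))) = 0"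
proof -
  obtain R where R: "\<Omega> \<subseteq> cball 0 R"
    using \<Omega>(2) unfolding bounded_iff by (meson mem_cball_0 subsetI)
  define q where "q x = g' x (axis k 1) + \<i> * g' x (axis k \<i>)" for x
  define N where "N x = (\<Sum>b\<in>Basis. norm (g' x b))" for x
  have qc: "continuous_on UNIV q" and Nc: "continuous_on UNIV N"
    unfolding q_def N_def using g(2) by (auto intro!: continuous_intros)
  have gc: "continuous_on UNIV g"
    using g(1) by (meson continuous_at_imp_continuous_on has_derivative_continuous)
  have bnd: "\<exists>B>0. \<forall>x\<in>cball 0 R. norm (u x) \<le> B" if "continuous_on UNIV u" for u :: "complex ^ 'n \<Rightarrow> 'b::euclidean_space"
  proof -
    have "compact (u ` cball 0 R)"
      using that by (intro compact_continuous_image compact_cball) (rule continuous_on_subset, auto)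
    then show ?thesis using bounded_pos[of "u ` cball 0 R"] compact_imp_bounded by auto
  qed
  obtain B where B: "B > 0" "\<And>x. x \<in> cball 0 R \<Longrightarrow> norm (g x) \<le> B" using bnd[OF gc] by blast
  obtain M where M: "M > 0" "\<And>x. x \<in> cball 0 R \<Longrightarrow> norm (N x) \<le> M" using bnd[OF Nc] by blast
  obtain Q where Q: "Q > 0" "\<And>x. x \<in> cball 0 R \<Longrightarrow> norm (q x) \<le> Q" using bnd[OF qc] by blast
  \<comment> \<open>\<open>\<Omega>\<close> may fail to be convex, so the mean value inequality is
    applied on a ball containing it; this is why \<open>g\<close> is differentiable on the whole
    space.\<close>
  have lip: "norm (g x - g y) \<le> M * norm (x - y)" if "x \<in> \<Omega>" "y \<in> \<Omega>" for x y
  proof (rule differentiable_bound[of "cball 0 R" g g'])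
    show "onorm (g' x) \<le> M" if "x \<in> cball 0 R" for x
    proof -
      have "onorm (g' x) \<le> N x"
        unfolding N_def by (rule onorm_componentwise) (use g(1) has_derivative_bounded_linear in blast)
      then show ?thesis using M(2)[OF that] by simp
    qed
    show "(g has_derivative g' x) (at x within cball 0 R)" for x
      using g(1) by (rule has_derivative_at_withinI)
  qed (use that R in auto)
  have "(LINT x:\<Omega>|lborel. h x * (q x / of_real B)) = 0"
  proof (rule flux_cutoff_pairing_zero[OF \<Omega> h, where k = k and g = "\<lambda>x. g x / of_real B" and Q = "Q / B" and M = "M / B"])
    show "((\<lambda>x. g x / of_real B) has_derivative (\<lambda>v. g' x v / of_real B)) (at x)" for x
      using bounded_linear.has_derivative[OF bounded_linear_divide g(1)] .
    show "norm (g x / of_real B - g y / of_real B) \<le> M / B * norm (x - y)" if "x \<in> \<Omega>" "y \<in> \<Omega>" for x y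
      using lip[OF that] B(1) by (simp add: diff_divide_distrib[symmetric] norm_divide divide_right_mono)
    show "norm (g x / of_real B) \<le> 1" if "x \<in> \<Omega>" for x
      using B R that by (auto simp: norm_divide)
    show "norm (q x / of_real B) \<le> Q / B" if "x \<in> \<Omega>" for x
      using Q B R that by (auto simp: norm_divide intro!: divide_right_mono)
    show "continuous_on \<Omega> (\<lambda>x. q x / of_real B)"
      using B(1) by (intro continuous_intros continuous_on_subset[OF qc]) auto
  qed (use M B cut in \<open>auto simp: q_def add_divide_distrib\<close>)
  then show ?thesis using B(1) by (simp add: q_def)
qed

text \<open>Twice d-bar_k multiplies the exponential by the constant \<open>a\<close>. For
  \<open>a \<noteq> 0\<close> division by \<open>a\<close> gives a primitive; for
  \<open>a = 0\<close> the exponential is killed by d-bar_k, and multiplying it by the real part of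
  the coordinate \<open>k\<close> gives one.\<close>

lemma flux_cutoff_exponential_moment_zero:
  fixes \<Omega> :: "(complex ^ 'n) set"
  assumes \<Omega>: "open \<Omega>" "bounded \<Omega>" and h: "holomorphic_several_on h \<Omega>" "set_integrable lborel \<Omega> h"
    and cut: "\<And>m. m > 0 \<Longrightarrow> \<exists>\<phi>. flux_cutoff \<Omega> h m \<phi>"
  shows "(LINT x:\<Omega>|lborel. h x * of_real (exp (\<xi> \<bullet> x))) = 0"
proof -
  \<comment> \<open>One coordinate suffices, and any will do: index types are nonempty.\<close>
  define k :: 'n where "k = undefined"
  define a where "a = Complex (\<xi> \<bullet> axis k 1) (\<xi> \<bullet> axis k \<i>)"
  note pairing = flux_cutoff_pairing_zero_C1[OF \<Omega> h cut, where k = k]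
  show ?thesis
  proof (cases "a = 0")
    case False
    define g' where "g' x v = of_real ((\<xi> \<bullet> v) * exp (\<xi> \<bullet> x)) / a" for x v
    have "((\<lambda>x. of_real (exp (\<xi> \<bullet> x)) / a) has_derivative g' x) (at x)" for x
      unfolding g'_def[abs_def] using False
      by (auto intro!: derivative_eq_intros simp: mult_ac)
    moreover have "continuous_on UNIV (\<lambda>x. g' x v)" for v
      unfolding g'_def using False by (intro continuous_intros) auto
    moreover have "g' x (axis k 1) + \<i> * g' x (axis k \<i>) = of_real (exp (\<xi> \<bullet> x))" for x
    proof -
      have "g' x (axis k 1) + \<i> * g' x (axis k \<i>) = a * of_real (exp (\<xi> \<bullet> x)) / a"
        by (simp add: g'_def a_def complex_eq_iff Complex_eq algebra_simps add_divide_distrib)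
      then show ?thesis using False by simp
    qed
    ultimately show ?thesis using pairing[of "\<lambda>x. of_real (exp (\<xi> \<bullet> x)) / a" g'] by simp
  next
    case True
    then have z: "\<xi> \<bullet> axis k 1 = 0" "\<xi> \<bullet> axis k \<i> = 0" by (auto simp: a_def complex_eq_iff)
    \<comment> \<open>here \<open>exp (\<xi> \<bullet> x)\<close> is independent of the coordinate \<open>k\<close>\<close>
    define g' where "g' x v = complex_of_real ((v \<bullet> axis k 1) * exp (\<xi> \<bullet> x) + (x \<bullet> axis k 1) * ((\<xi> \<bullet> v) * exp (\<xi> \<bullet> x)))"
      for x v :: "complex ^ 'n"
    have "((\<lambda>x. complex_of_real ((x \<bullet> axis k 1) * exp (\<xi> \<bullet> x))) has_derivative g' x) (at x)" for x
      unfolding g'_def[abs_def] by (auto intro!: derivative_eq_intros simp: mult_ac)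
    moreover have "continuous_on UNIV (\<lambda>x. g' x v)" for v
      unfolding g'_def by (intro continuous_intros)
    moreover have "g' x (axis k 1) + \<i> * g' x (axis k \<i>) = of_real (exp (\<xi> \<bullet> x))" for x
      using z by (simp add: g'_def inner_axis_axis)
    ultimately show ?thesis
      using pairing[of "\<lambda>x. complex_of_real ((x \<bullet> axis k 1) * exp (\<xi> \<bullet> x))" g'] by simp
  qed
qed

text \<open>The criterion behind both parts: the weight and the capacity enter only through the
  construction of low-flux cutoffs. Boundedness of \<open>\<Omega>\<close> gives the zero extension
  of \<open>h\<close> a compact support.\<close>

lemma flux_cutoff_imp_zero:
  fixes \<Omega> :: "(complex ^ 'n) set"
  assumes \<Omega>: "open \<Omega>" "bounded \<Omega>" and h: "holomorphic_several_on h \<Omega>" "set_integrable lborel \<Omega> h"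
    and cut: "\<And>m. m > 0 \<Longrightarrow> \<exists>\<phi>. flux_cutoff \<Omega> h m \<phi>"
    and z: "z \<in> \<Omega>"
  shows "h z = 0"
proof (rule continuous_moments_zero_imp_zero[OF \<Omega>(1) _ _ _ z])
  show "continuous_on \<Omega> h" using h(1) by (rule holomorphic_several_on_continuous)
  show int: "integrable lborel (\<lambda>x. indicator \<Omega> x *\<^sub>R h x)"
    using h(2) by (simp add: set_integrable_def)
  fix u :: "complex ^ 'n \<Rightarrow> real" assume u: "continuous_on UNIV u"
  show "(LINT x|lborel. (indicator \<Omega> x *\<^sub>R h x) * of_real (u x)) = 0"
  proof (rule exponential_moments_zero[OF int _ _ _ u])
    show "compact (closure \<Omega>)" using \<Omega>(2) by simp
    show "(LINT x|lborel. (indicator \<Omega> x *\<^sub>R h x) * of_real (exp (\<xi> \<bullet> x))) = 0" for \<xi>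
      using flux_cutoff_exponential_moment_zero[OF \<Omega> h cut, of \<xi>]
      by (simp add: set_lebesgue_integral_def)
  qed (use closure_subset in \<open>auto simp: indicator_def\<close>)
qed

section \<open>Logarithmic cutoffs\<close>

lemma abs_ln_diff_le:
  fixes a b c :: real
  assumes "0 < c" "c \<le> a" "c \<le> b"
  shows "\<bar>ln a - ln b\<bar> \<le> \<bar>a - b\<bar> / c"
proof -
  have *: "ln x - ln y \<le> \<bar>x - y\<bar> / c" if "c \<le> x" "c \<le> y" for x y
  proof -
    have pos: "0 < x" "0 < y" using that assms(1) by linarith+
    have "ln x - ln y = ln (x / y)" using pos by (simp add: ln_div)
    also have "\<dots> \<le> x / y - 1" using pos by (intro ln_le_minus_one) simp
    also have "\<dots> = (x - y) / y" using pos by (simp add: field_simps)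
    also have "\<dots> \<le> \<bar>x - y\<bar> / c"
      using that assms(1) by (intro frac_le) auto
    finally show ?thesis .
  qed
  from *[of a b] *[of b a] assms show ?thesis by (simp add: abs_minus_commute)
qed

text \<open>Difference form of the fact that ln (1 + ln (D/s)) has a derivative of size 1 / (s (1 +
  ln (D/s))). The factor 4 is two halvings: the smaller argument of each of the two logarithms is
  bounded below by half of the value at \<open>\<sigma>\<close>.\<close>

lemma loglog_diff_le:
  fixes \<sigma> \<tau> t D :: real
  assumes "0 < \<sigma>" "\<sigma> \<le> D" "\<sigma> / 2 \<le> \<tau>" "\<tau> \<le> D" "\<bar>\<sigma> - \<tau>\<bar> \<le> t" "t \<le> \<sigma> / 2"
  shows "\<bar>ln (1 + ln D - ln \<sigma>) - ln (1 + ln D - ln \<tau>)\<bar> \<le> 4 * t / (\<sigma> * (1 + ln D - ln \<sigma>))"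
proof -
  let ?A = "1 + ln D - ln \<sigma>" and ?B = "1 + ln D - ln \<tau>"
  have pos: "\<tau> > 0" using assms(1,3) by simp
  have A: "?A \<ge> 1" "?B \<ge> 1" using assms pos by simp_all
  have "\<bar>ln \<sigma> - ln \<tau>\<bar> \<le> \<bar>\<sigma> - \<tau>\<bar> / (\<sigma> / 2)" using assms by (intro abs_ln_diff_le) auto
  also have "\<dots> \<le> t / (\<sigma> / 2)" using assms by (intro divide_right_mono) auto
  finally have l: "\<bar>ln \<sigma> - ln \<tau>\<bar> \<le> 2 * t / \<sigma>" by (simp add: mult.commute)
  also have "\<dots> \<le> 1" using assms by (simp add: field_simps)
  \<comment> \<open>The inner logarithms differ by at most 1, hence
    \<open>?A \<le> ?B + 1 \<le> 2 * ?B\<close>.\<close>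
  finally have "?A / 2 \<le> ?B" using A(2) by (auto simp: abs_le_iff)
  then have "\<bar>ln ?A - ln ?B\<bar> \<le> \<bar>?A - ?B\<bar> / (?A / 2)" using A by (intro abs_ln_diff_le) auto
  also have "\<dots> \<le> (2 * t / \<sigma>) / (?A / 2)" using l A(1) by (intro divide_right_mono) (auto simp: abs_minus_commute)
  finally show ?thesis by (simp add: mult.commute mult.left_commute)
qed

text \<open>The derivative of s (1 + ln (D/s)) is ln (D/s), nonnegative up to s = D; without the
  summand 1 monotonicity would fail near D. It turns bounds in the truncated distance into bounds in
  the distance itself.\<close>

lemma times_log_mono:
  fixes s \<sigma> D :: real
  assumes "0 < s" "s \<le> \<sigma>" "\<sigma> \<le> D"
  shows "s * (1 + ln D - ln s) \<le> \<sigma> * (1 + ln D - ln \<sigma>)"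
proof -
  have "ln (\<sigma> / s) \<le> \<sigma> / s - 1" using assms by (intro ln_le_minus_one) simp
  then have "s * (ln \<sigma> - ln s) \<le> \<sigma> - s" using assms by (simp add: ln_div field_simps)
  moreover have "(\<sigma> - s) * 1 \<le> (\<sigma> - s) * (1 + ln D - ln \<sigma>)" using assms by (intro mult_left_mono) auto
  ultimately show ?thesis by (simp add: algebra_simps)
qed

section \<open>Measurability on open sets and the distance to the complement\<close>

lemma ennreal_times_indicator_borel:
  fixes F :: "'a::topological_space \<Rightarrow> real"
  assumes "open \<Omega>" "continuous_on \<Omega> F"
  shows "(\<lambda>x. ennreal (F x) * indicator \<Omega> x) \<in> borel_measurable borel"
proof -
  have "(\<lambda>x. ennreal (indicator \<Omega> x *\<^sub>R F x)) \<in> borel_measurable borel"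
    using assms by (intro measurable_compose[OF _ measurable_ennreal] borel_measurable_continuous_on_indicator) auto
  moreover have "(\<lambda>x. ennreal (indicator \<Omega> x *\<^sub>R F x)) = (\<lambda>x. ennreal (F x) * indicator \<Omega> x)"
    by (auto simp: indicator_def)
  ultimately show ?thesis by simp
qed

lemma infdist_Compl_pos:
  assumes "open \<Omega>" "bounded \<Omega>" "x \<in> \<Omega>"
  shows "infdist x (- \<Omega> :: 'a::euclidean_space set) > 0"
proof -
  have "- \<Omega> \<noteq> {}" using assms(2) not_bounded_UNIV by (metis Compl_empty_eq double_complement)
  then show ?thesis using assms by (intro infdist_pos_not_in_closed) (auto simp: closed_def)
qed

lemma compact_infdist_Compl_ge:
  fixes \<Omega> :: "'a::euclidean_space set"
  assumes "bounded \<Omega>" "\<eta> > 0"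
  shows "compact {x. \<eta> \<le> infdist x (- \<Omega>)}" "{x. \<eta> \<le> infdist x (- \<Omega>)} \<subseteq> \<Omega>"
proof -
  show sub: "{x. \<eta> \<le> infdist x (- \<Omega>)} \<subseteq> \<Omega>"
  proof
    fix x assume "x \<in> {x. \<eta> \<le> infdist x (- \<Omega>)}"
    with assms(2) have "infdist x (- \<Omega>) \<noteq> 0" by simp
    then show "x \<in> \<Omega>" by (metis Compl_iff infdist_zero)
  qed
  have "closed {x. \<eta> \<le> infdist x (- \<Omega>)}"
    by (intro closed_Collect_le continuous_intros)
  with sub assms(1) show "compact {x. \<eta> \<le> infdist x (- \<Omega>)}"
    by (auto simp: compact_eq_bounded_closed intro: bounded_subset)
qed

text \<open>Write l for ln (1 + ln (D/d)), with d the distance to the complement. The cutoff is 2 -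
  l/N clamped to [0,1]: it is 1 where l \<le> N and 0 where l \<ge> 2N. Its difference quotients are
  at most 4/N times the given weight, so a finite weighted integral of \<open>norm (h x)\<close>
  makes the flux small for large N.\<close>

lemma log_flux_cutoff:
  fixes \<Omega> :: "'a::euclidean_space set" and h :: "'a \<Rightarrow> complex"
  assumes \<Omega>: "open \<Omega>" "bounded \<Omega>" and h: "continuous_on \<Omega> h"
    and D: "D > 0" "\<And>x. infdist x (- \<Omega>) \<le> D"
    and fin: "(\<integral>\<^sup>+x\<in>\<Omega>. ennreal (norm (h x) / (infdist x (- \<Omega>) * (1 + ln D - ln (infdist x (- \<Omega>))))) \<partial>lborel) < \<infinity>"
    and m: "m > 0"
  shows "\<exists>\<phi>. flux_cutoff \<Omega> h m \<phi>"
proof -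
  define d where "d x = infdist x (- \<Omega>)" for x
  define w where "w x = norm (h x) / (d x * (1 + ln D - ln (d x)))" for x
  have dpos: "d x > 0" if "x \<in> \<Omega>" for x unfolding d_def using infdist_Compl_pos[OF \<Omega> that] .
  have dD: "d x \<le> D" for x unfolding d_def by (rule D(2))
  have dc: "continuous_on S d" for S unfolding d_def by (intro continuous_intros)
  have wpos: "d x * (1 + ln D - ln (d x)) > 0" if "x \<in> \<Omega>" for x
    using dpos[OF that] dD[of x] by (intro mult_pos_pos) (auto simp: add_pos_nonneg add_diff_eq[symmetric])
  have "continuous_on \<Omega> w"
    unfolding w_def using h dc dpos wpos by (intro continuous_intros) (auto simp: less_le)
  then have wb: "(\<lambda>x. ennreal (w x) * indicator \<Omega> x) \<in> borel_measurable lborel"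
    using \<Omega>(1) ennreal_times_indicator_borel by simp
  obtain i where i: "(\<integral>\<^sup>+x\<in>\<Omega>. ennreal (w x) \<partial>lborel) = ennreal i" "i \<ge> 0"
    using fin unfolding w_def d_def by (auto simp: less_top_ennreal)
  \<comment> \<open>The summand \<open>4 * i / m\<close> brings the flux below \<open>m\<close>, the
    logarithmic one makes the cutoff 1 at distance at least \<open>m\<close>, and the 1 makes
    \<open>N\<close> positive.\<close>
  define N where "N = 1 + 4 * i / m + \<bar>ln (1 + ln D - ln m)\<bar>"
  have "4 * i / m \<ge> 0" using i(2) m by simp
  then have N: "N > 0" "4 * i / m \<le> N" "ln (1 + ln D - ln m) \<le> N" unfolding N_def by linarith+
  \<comment> \<open>The distance at which the iterated logarithm equals \<open>2 * N\<close>, so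
    that the cutoff has dropped to 0.\<close>
  define \<eta> where "\<eta> = D * exp (1 - exp (2 * N))"
  have \<eta>: "\<eta> > 0" using D by (simp add: \<eta>_def)
  have "exp (1 - exp (2 * N)) \<le> exp 0" using N(1) by (intro exp_le_cancel_iff[THEN iffD2]) simp
  then have \<eta>D: "\<eta> \<le> D" using D by (simp add: \<eta>_def)
  have l\<eta>: "ln (1 + ln D - ln \<eta>) = 2 * N" using D by (simp add: \<eta>_def ln_mult)
  \<comment> \<open>Truncation at \<open>\<eta>\<close> keeps the logarithms meaningful where the
    distance is 0, so the cutoff is continuous on the whole space without changing where it is
    nonzero.\<close>
  define \<sigma> where "\<sigma> x = max (d x) \<eta>" for x
  define \<phi> where "\<phi> x = max 0 (min 1 (2 - ln (1 + ln D - ln (\<sigma> x)) / N))" for x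
  have \<sigma>: "\<eta> \<le> \<sigma> x" "0 < \<sigma> x" "d x \<le> \<sigma> x" "\<sigma> x \<le> D" for x using \<eta> \<eta>D dD by (auto simp: \<sigma>_def)
  have A: "1 + ln D - ln (\<sigma> x) \<ge> 1" for x using \<sigma>[of x] by simp
  define \<kappa> where "\<kappa> x = 4 / N / (d x * (1 + ln D - ln (d x)))" for x
  show ?thesis unfolding flux_cutoff_def
  proof (intro exI conjI)
    have nz: "1 + ln D - ln (\<sigma> x) \<noteq> 0" for x using A[of x] by linarith
    have nz2: "\<sigma> x \<noteq> 0" for x using \<sigma>[of x] by linarith
    show "continuous_on UNIV \<phi>"
      unfolding \<phi>_def using nz nz2 N(1)
      by (intro continuous_intros) (auto simp: \<sigma>_def intro!: continuous_intros dc)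
    show "\<forall>x. 0 \<le> \<phi> x \<and> \<phi> x \<le> 1" by (simp add: \<phi>_def)
    show "compact {x. \<eta> \<le> infdist x (- \<Omega>)}" "{x. \<eta> \<le> infdist x (- \<Omega>)} \<subseteq> \<Omega>"
      using compact_infdist_Compl_ge[OF \<Omega>(2) \<eta>] .
    show "\<forall>x. x \<notin> {x. \<eta> \<le> infdist x (- \<Omega>)} \<longrightarrow> \<phi> x = 0"
      using l\<eta> N(1) by (auto simp: \<phi>_def \<sigma>_def d_def max_def)
    show "\<forall>x\<in>\<Omega>. m \<le> infdist x (- \<Omega>) \<longrightarrow> \<phi> x = 1"
    proof (intro ballI impI)
      fix x assume "m \<le> infdist x (- \<Omega>)"
      then have "m \<le> \<sigma> x" using \<sigma>(3)[of x] by (simp add: d_def)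
      then have "ln m \<le> ln (\<sigma> x)" using m by simp
      then have "ln (1 + ln D - ln (\<sigma> x)) \<le> ln (1 + ln D - ln m)" using A[of x] by simp
      with N(3) have "ln (1 + ln D - ln (\<sigma> x)) / N \<le> 1" using N(1) by (simp add: field_simps)
      then show "\<phi> x = 1" by (simp add: \<phi>_def)
    qed
    \<comment> \<open>Steps below \<open>\<eta> / 2\<close> are at most half of
      \<open>\<sigma> x\<close> for every \<open>x\<close>, as \<open>loglog_diff_le\<close>
      demands.\<close>
    show "\<eta> / 2 > 0" using \<eta> by simp
    show "\<forall>x\<in>\<Omega>. \<forall>v\<in>Basis. \<forall>t. 0 < t \<and> t < \<eta> / 2 \<longrightarrow> \<bar>\<phi> (x + t *\<^sub>R v) - \<phi> x\<bar> \<le> t * \<kappa> x"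
    proof (intro ballI allI impI)
      fix x v t assume x: "x \<in> \<Omega>" and v: "v \<in> (Basis :: 'a set)" and t: "0 < t \<and> t < \<eta> / 2"
      let ?y = "x + t *\<^sub>R v"
      have "\<bar>d x - d ?y\<bar> \<le> dist x ?y" unfolding d_def by (rule infdist_triangle_abs)
      also have "\<dots> = t" using v t by (simp add: dist_norm)
      finally have "\<bar>\<sigma> x - \<sigma> ?y\<bar> \<le> t" by (auto simp: \<sigma>_def max_def)
      then have "\<bar>ln (1 + ln D - ln (\<sigma> x)) - ln (1 + ln D - ln (\<sigma> ?y))\<bar> \<le> 4 * t / (\<sigma> x * (1 + ln D - ln (\<sigma> x)))"
        using \<sigma>[of x] \<sigma>[of ?y] t by (intro loglog_diff_le) auto
      also have "\<dots> \<le> 4 * t / (d x * (1 + ln D - ln (d x)))"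
        using times_log_mono[OF dpos[OF x] \<sigma>(3,4)] wpos[OF x] t by (intro frac_le) auto
      finally have "\<bar>ln (1 + ln D - ln (\<sigma> x)) - ln (1 + ln D - ln (\<sigma> ?y))\<bar> / N \<le>
          4 * t / (d x * (1 + ln D - ln (d x))) / N"
        using N(1) by (intro divide_right_mono) auto
      also have "\<dots> = t * \<kappa> x" by (simp add: \<kappa>_def mult.commute)
      finally have le: "\<bar>ln (1 + ln D - ln (\<sigma> x)) - ln (1 + ln D - ln (\<sigma> ?y))\<bar> / N \<le> t * \<kappa> x" .
      have clamp: "\<bar>max 0 (min 1 a) - max 0 (min 1 b)\<bar> \<le> \<bar>a - b\<bar>" for a b :: real
        by (auto simp: max_def min_def)
      have "\<bar>\<phi> ?y - \<phi> x\<bar> \<le> \<bar>(2 - ln (1 + ln D - ln (\<sigma> ?y)) / N) - (2 - ln (1 + ln D - ln (\<sigma> x)) / N)\<bar>"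
        unfolding \<phi>_def by (rule clamp)
      also have "\<dots> = \<bar>ln (1 + ln D - ln (\<sigma> x)) - ln (1 + ln D - ln (\<sigma> ?y))\<bar> / N"
        using N(1) by (simp add: diff_divide_distrib[symmetric])
      finally show "\<bar>\<phi> ?y - \<phi> x\<bar> \<le> t * \<kappa> x" using le by simp
    qed
    have hk: "norm (h x) * \<kappa> x = 4 / N * w x" for x by (simp add: \<kappa>_def w_def)
    have "ennreal (norm (h x) * \<kappa> x) * indicator \<Omega> x = ennreal (4 / N) * (ennreal (w x) * indicator \<Omega> x)" for x
      unfolding hk by (subst ennreal_mult') (use N(1) in \<open>auto simp: mult.assoc\<close>)
    then have "(\<integral>\<^sup>+x\<in>\<Omega>. ennreal (norm (h x) * \<kappa> x) \<partial>lborel) = (\<integral>\<^sup>+x. ennreal (4 / N) * (ennreal (w x) * indicator \<Omega> x) \<partial>lborel)"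
      by simp
    also have "\<dots> = ennreal (4 / N) * ennreal i"
      using wb by (simp add: nn_integral_cmult i(1))
    also have "\<dots> = ennreal (4 / N * i)" using N(1) i(2) by (intro ennreal_mult[symmetric]) auto
    also have "\<dots> \<le> ennreal m" using N(1,2) m by (intro ennreal_leI) (simp add: field_simps)
    finally show "(\<integral>\<^sup>+x\<in>\<Omega>. ennreal (norm (h x) * \<kappa> x) \<partial>lborel) \<le> ennreal m" .
  qed
qed

section \<open>Cutoffs from the capacity\<close>

text \<open>The segment from \<open>x\<close> to a nearest point of the complement must cross the
  frontier; conversely the frontier of an open set lies in its complement. The distance to the
  complement is the convenient one, since it vanishes off \<open>\<Omega>\<close>.\<close>

lemma bdist_eq_infdist_Compl:
  fixes \<Omega> :: "'a::euclidean_space set"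
  assumes "open \<Omega>" "bounded \<Omega>" "x \<in> \<Omega>"
  shows "bdist \<Omega> x = infdist x (- \<Omega>)"
proof -
  have ne: "- \<Omega> \<noteq> {}" using assms(2) not_bounded_UNIV by (metis Compl_empty_eq double_complement)
  have "closed (- \<Omega>)" using assms(1) by (simp add: closed_def)
  then obtain y where y: "y \<in> - \<Omega>" "infdist x (- \<Omega>) = dist x y"
    using infdist_attains_inf[OF _ ne] by metis
  have "closed_segment x y \<inter> frontier \<Omega> \<noteq> {}"
    by (rule connected_Int_frontier) (use assms(3) y(1) in auto)
  then obtain z where z: "z \<in> closed_segment x y" "z \<in> frontier \<Omega>" by blast
  have "infdist x (frontier \<Omega>) \<le> dist x z" using z(2) by (rule infdist_le)
  also have "\<dots> \<le> dist x y" using segment_bound(1)[OF z(1)] by (simp add: dist_norm norm_minus_commute)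
  finally have "bdist \<Omega> x \<le> infdist x (- \<Omega>)" by (simp add: bdist_def y(2))
  moreover have "infdist x (- \<Omega>) \<le> bdist \<Omega> x"
    unfolding bdist_def using z(2) assms(1)
    by (intro infdist_mono) (auto simp: frontier_def interior_open)
  ultimately show ?thesis by simp
qed

text \<open>The normalisation \<open>D \<ge> 1\<close> makes \<open>ln D\<close> nonnegative, which
  is used when the weights 1 + |ln d| and 1 + ln (D/d) are compared.\<close>

lemma infdist_Compl_bounded:
  fixes \<Omega> :: "'a::euclidean_space set"
  assumes "bounded \<Omega>"
  obtains D where "D \<ge> 1" "\<And>x. infdist x (- \<Omega>) \<le> D"
proof -
  obtain p where p: "p \<in> - \<Omega>" using assms not_bounded_UNIV by (metis ComplI UNIV_eq_I)
  obtain e where e: "\<And>y. y \<in> \<Omega> \<Longrightarrow> dist p y \<le> e" using assms bounded_any_center by blast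
  have "infdist x (- \<Omega>) \<le> max 1 e" for x
  proof (cases "x \<in> \<Omega>")
    case True
    then show ?thesis using infdist_le[OF p, of x] e[OF True] by (simp add: dist_commute)
  next
    case False
    then have "infdist x (- \<Omega>) = 0" by (intro infdist_zero) simp
    then show ?thesis by simp
  qed
  then show ?thesis by (intro that[of "max 1 e"]) auto
qed

section \<open>Integrability over an open set\<close>

lemma nn_integral_finite_bound:
  fixes \<Omega> :: "'a::euclidean_space set"
  assumes "open \<Omega>" "continuous_on \<Omega> g" "(\<integral>\<^sup>+x\<in>\<Omega>. ennreal (g x) \<partial>lborel) < \<infinity>" "c \<ge> 0"
    and le: "\<And>x. x \<in> \<Omega> \<Longrightarrow> F x \<le> c * g x"
  shows "(\<integral>\<^sup>+x\<in>\<Omega>. ennreal (F x) \<partial>lborel) < \<infinity>"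
proof -
  have [measurable]: "(\<lambda>x. ennreal (g x) * indicator \<Omega> x) \<in> borel_measurable lborel"
    using assms(1,2) ennreal_times_indicator_borel by simp
  have "(\<integral>\<^sup>+x\<in>\<Omega>. ennreal (F x) \<partial>lborel) \<le> (\<integral>\<^sup>+x. ennreal c * (ennreal (g x) * indicator \<Omega> x) \<partial>lborel)"
  proof (rule nn_integral_mono)
    fix x
    show "ennreal (F x) * indicator \<Omega> x \<le> ennreal c * (ennreal (g x) * indicator \<Omega> x)"
      using le[of x] assms(4) by (auto simp: indicator_def ennreal_mult'[symmetric] intro!: ennreal_leI)
  qed
  also have "\<dots> = ennreal c * (\<integral>\<^sup>+x\<in>\<Omega>. ennreal (g x) \<partial>lborel)" by (simp add: nn_integral_cmult)
  also have "\<dots> < \<infinity>" using assms(3) by (simp add: ennreal_mult_less_top)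
  finally show ?thesis .
qed

lemma set_integrable_lborelI:
  fixes \<Omega> :: "'a::euclidean_space set" and h :: "'a \<Rightarrow> complex"
  assumes "open \<Omega>" "continuous_on \<Omega> h" "(\<integral>\<^sup>+x\<in>\<Omega>. ennreal (norm (h x)) \<partial>lborel) < \<infinity>"
  shows "set_integrable lborel \<Omega> h"
  unfolding set_integrable_def
proof (rule integrableI_bounded)
  show "(\<lambda>x. indicator \<Omega> x *\<^sub>R h x) \<in> borel_measurable lborel"
    using assms(1,2) by (simp add: borel_measurable_continuous_on_indicator)
  have "(\<integral>\<^sup>+x. ennreal (norm (indicator \<Omega> x *\<^sub>R h x)) \<partial>lborel) = (\<integral>\<^sup>+x\<in>\<Omega>. ennreal (norm (h x)) \<partial>lborel)"
    by (intro nn_integral_cong) (auto simp: indicator_def)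
  then show "(\<integral>\<^sup>+x. ennreal (norm (indicator \<Omega> x *\<^sub>R h x)) \<partial>lborel) < \<infinity>" using assms(3) by simp
qed

text \<open>The mean value theorem expresses the quotient by the derivative at a nearby point, and
  uniform continuity moves that point back to \<open>x\<close> at the cost of \<open>\<eta>\<close>.
  The threshold for the step is uniform over \<open>\<Omega>\<close> and over the finite
  basis.\<close>

lemma C1_directional_difference:
  fixes \<phi> :: "'a::euclidean_space \<Rightarrow> real"
  assumes \<phi>: "C_class 1 \<phi>" and "bounded \<Omega>" "\<eta> > 0"
  obtains t\<^sub>0 where "t\<^sub>0 > 0"
    "\<And>x b t. x \<in> \<Omega> \<Longrightarrow> b \<in> Basis \<Longrightarrow> 0 < t \<Longrightarrow> t < t\<^sub>0 \<Longrightarrow>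
       \<bar>\<phi> (x + t *\<^sub>R b) - \<phi> x\<bar> \<le> t * (\<bar>frechet_derivative \<phi> (at x) b\<bar> + \<eta>)"
proof -
  have diff: "\<And>x. \<phi> differentiable (at x)"
    and cont: "\<And>b. b \<in> Basis \<Longrightarrow> continuous_on UNIV (\<lambda>x. frechet_derivative \<phi> (at x) b)"
    using \<phi> by (auto simp: One_nat_def)
  obtain R where R: "\<And>x. x \<in> \<Omega> \<Longrightarrow> norm x \<le> R" using assms(2) unfolding bounded_iff by blast
  have "\<forall>\<^sub>F t in at_right 0. \<forall>x\<in>\<Omega>. \<bar>\<phi> (x + t *\<^sub>R b) - \<phi> x\<bar> \<le> t * (\<bar>frechet_derivative \<phi> (at x) b\<bar> + \<eta>)"
    if b: "b \<in> Basis" for b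
  proof -
    define u where "u x = frechet_derivative \<phi> (at x) b" for x
    \<comment> \<open>Radius \<open>R + 1\<close> leaves room for steps shorter than 1.\<close>
    have "uniformly_continuous_on (cball 0 (R + 1)) u"
      unfolding u_def using cont[OF b] by (intro compact_uniformly_continuous) (auto intro: continuous_on_subset)
    then obtain s where s: "s > 0"
      "\<And>x y. x \<in> cball 0 (R + 1) \<Longrightarrow> y \<in> cball 0 (R + 1) \<Longrightarrow> dist y x < s \<Longrightarrow> dist (u y) (u x) < \<eta>"
      using assms(3) unfolding uniformly_continuous_on_def by metis
    have "\<bar>\<phi> (x + t *\<^sub>R b) - \<phi> x\<bar> \<le> t * (\<bar>u x\<bar> + \<eta>)" if x: "x \<in> \<Omega>" and t: "0 < t" "t < min s 1" for x t
    proof -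
      have der: "((\<lambda>r. \<phi> (x + r *\<^sub>R b)) has_real_derivative u (x + r *\<^sub>R b)) (at r)" for r
      proof -
        have "(\<phi> has_derivative frechet_derivative \<phi> (at (x + r *\<^sub>R b))) (at (x + r *\<^sub>R b))"
          using diff frechet_derivative_works by blast
        moreover have "((\<lambda>r. x + r *\<^sub>R b) has_derivative (\<lambda>r. r *\<^sub>R b)) (at r)"
          by (auto intro!: derivative_eq_intros)
        ultimately have "((\<lambda>r. \<phi> (x + r *\<^sub>R b)) has_derivative (\<lambda>q. frechet_derivative \<phi> (at (x + r *\<^sub>R b)) (q *\<^sub>R b))) (at r)"
          using has_derivative_compose by blast
        moreover have "frechet_derivative \<phi> (at (x + r *\<^sub>R b)) (q *\<^sub>R b) = u (x + r *\<^sub>R b) * q" for q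
          unfolding u_def using linear_frechet_derivative[OF diff] by (simp add: linear_cmul)
        ultimately show ?thesis by (simp add: has_field_derivative_def)
      qed
      obtain z where z: "0 < z" "z < t" "\<phi> (x + t *\<^sub>R b) - \<phi> (x + 0 *\<^sub>R b) = (t - 0) * u (x + z *\<^sub>R b)"
        using MVT2[OF t(1), of "\<lambda>r. \<phi> (x + r *\<^sub>R b)" "\<lambda>r. u (x + r *\<^sub>R b)"] der by blast
      have "norm (x + z *\<^sub>R b) \<le> norm x + z" using norm_triangle_ineq[of x "z *\<^sub>R b"] b z(1) by simp
      then have "x + z *\<^sub>R b \<in> cball 0 (R + 1)" "x \<in> cball 0 (R + 1)" using R[OF x] z t by auto
      moreover have "dist (x + z *\<^sub>R b) x < s" using b z t by (simp add: dist_norm)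
      ultimately have "dist (u (x + z *\<^sub>R b)) (u x) < \<eta>" using s(2) by blast
      then have "\<bar>u (x + z *\<^sub>R b)\<bar> \<le> \<bar>u x\<bar> + \<eta>" unfolding dist_real_def by linarith
      then show ?thesis using z t by (simp add: abs_mult)
    qed
    then show ?thesis unfolding eventually_at_right_field u_def
      using s(1) by (intro exI[of _ "min s 1"]) auto
  qed
  then have "\<forall>\<^sub>F t in at_right 0. \<forall>b\<in>Basis. \<forall>x\<in>\<Omega>. \<bar>\<phi> (x + t *\<^sub>R b) - \<phi> x\<bar> \<le> t * (\<bar>frechet_derivative \<phi> (at x) b\<bar> + \<eta>)"
    by (intro eventually_ball_finite) auto
  then show ?thesis using that unfolding eventually_at_right_field by (metis (no_types, lifting))
qed

lemma ennreal_linear3: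
  assumes "0 \<le> a" "0 \<le> b" "0 \<le> c" "0 \<le> p" "0 \<le> q" "0 \<le> r"
  shows "ennreal (a * p + (b * q + c * r)) =
    ennreal a * ennreal p + (ennreal b * ennreal q + ennreal c * ennreal r)"
  using assms by (simp add: ennreal_mult)

text \<open>Cauchy-Schwarz with a weight \<open>l\<close>: |h| |grad phi| \<le> l/2 |h|^2 + |grad
  phi|^2 / (2 l). The gradient vanishes on \<open>U\<close>, so only the part of |h|^2 in the collar
  counts. This takes half of \<open>m\<close>; the other half absorbs the additive error of the
  difference quotients.\<close>

lemma test_function_flux_cutoff:
  fixes \<Omega> :: "'a::euclidean_space set" and h :: "'a \<Rightarrow> complex"
  assumes \<Omega>: "open \<Omega>" "bounded \<Omega>" and h: "continuous_on \<Omega> h" "(\<integral>\<^sup>+x\<in>\<Omega>. ennreal (norm (h x)) \<partial>lborel) < \<infinity>"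
    and \<phi>: "\<phi> \<in> test_functions \<Omega>" "\<And>x. 0 \<le> \<phi> x \<and> \<phi> x \<le> 1"
    and U: "open U" "{z\<in>\<Omega>. infdist z (- \<Omega>) > \<epsilon>} \<subseteq> U" "\<And>x. x \<in> U \<Longrightarrow> \<phi> x = 1"
    and E: "(\<integral>\<^sup>+x\<in>\<Omega>. ennreal (grad_sq \<phi> x) \<partial>lborel) \<le> ennreal E" "E \<ge> 0"
    and T: "(\<integral>\<^sup>+x\<in>\<Omega>. ennreal ((norm (h x))\<^sup>2) * indicator {x. infdist x (- \<Omega>) \<le> \<epsilon>} x \<partial>lborel) \<le> ennreal T" "T \<ge> 0"
    and l: "l > 0" "l / 2 * T + E / (2 * l) \<le> m / 2" and m: "m > 0" "\<epsilon> < m"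
  shows "flux_cutoff \<Omega> h m \<phi>"
proof -
  have C1: "C_class 1 \<phi>" using \<phi>(1) by (simp add: test_functions_def)
  obtain i where i: "(\<integral>\<^sup>+x\<in>\<Omega>. ennreal (norm (h x)) \<partial>lborel) = ennreal i" "i \<ge> 0"
    using h(2) by (auto simp: less_top_ennreal)
  \<comment> \<open>Chosen so that \<open>\<eta>\<close> times the L^1 norm \<open>i\<close> of
    \<open>h\<close> is at most \<open>m / 2\<close>, also when \<open>i = 0\<close>.\<close>
  define \<eta> where "\<eta> = m / (2 * (i + 1))"
  have \<eta>: "\<eta> > 0" "\<eta> * i \<le> m / 2" using m i(2) by (auto simp: \<eta>_def field_simps)
  obtain t\<^sub>0 where t0: "t\<^sub>0 > 0" "\<And>x b t. x \<in> \<Omega> \<Longrightarrow> b \<in> Basis \<Longrightarrow> 0 < t \<Longrightarrow> t < t\<^sub>0 \<Longrightarrow>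
       \<bar>\<phi> (x + t *\<^sub>R b) - \<phi> x\<bar> \<le> t * (\<bar>frechet_derivative \<phi> (at x) b\<bar> + \<eta>)"
    using C1_directional_difference[OF C1 \<Omega>(2) \<eta>(1)] by blast
  have g0: "grad_sq \<phi> x \<ge> 0" for x unfolding grad_sq_def by (simp add: sum_nonneg)
  have gle: "\<bar>frechet_derivative \<phi> (at x) b\<bar> \<le> sqrt (grad_sq \<phi> x)" if "b \<in> Basis" for b x
    unfolding grad_sq_def using that by (intro real_le_rsqrt) (auto intro: member_le_sum)
  \<comment> \<open>Openness of \<open>U\<close> turns the constancy of \<open>\<phi>\<close> into a
    vanishing derivative.\<close>
  have gU: "grad_sq \<phi> x = 0" if "x \<in> U" for x
  proof -
    have "((\<lambda>_. 1) has_derivative (\<lambda>_. 0)) (at x)" by (rule has_derivative_const)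
    then have "(\<phi> has_derivative (\<lambda>_. 0)) (at x)"
      by (rule has_derivative_transform_within_open[OF _ U(1) that]) (simp add: U(3))
    then have "frechet_derivative \<phi> (at x) = (\<lambda>_. 0)" by (rule frechet_derivative_at[symmetric])
    then show ?thesis by (simp add: grad_sq_def)
  qed
  have gc: "continuous_on S (grad_sq \<phi>)" for S
    using C1 unfolding grad_sq_def[abs_def]
    by (intro continuous_intros) (auto simp: One_nat_def intro: continuous_on_subset)
  define F1 where "F1 x = ennreal (norm (h x)) * indicator \<Omega> x" for x
  define F2 where "F2 x = ennreal ((norm (h x))\<^sup>2) * indicator \<Omega> x * indicator {x. infdist x (- \<Omega>) \<le> \<epsilon>} x" for x
  define F3 where "F3 x = ennreal (grad_sq \<phi> x) * indicator \<Omega> x" for x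
  have "closed {x. infdist x (- \<Omega>) \<le> \<epsilon>}" by (intro closed_Collect_le continuous_intros)
  then have cl: "{x. infdist x (- \<Omega>) \<le> \<epsilon>} \<in> sets borel" by simp
  have F1b[measurable]: "F1 \<in> borel_measurable lborel" and F3b[measurable]: "F3 \<in> borel_measurable lborel"
    unfolding F1_def[abs_def] F3_def[abs_def] measurable_lborel1
    using \<Omega>(1) h(1) gc by (auto intro!: ennreal_times_indicator_borel continuous_intros)
  have "(\<lambda>x. ennreal ((norm (h x))\<^sup>2) * indicator \<Omega> x) \<in> borel_measurable borel"
    using \<Omega>(1) h(1) by (intro ennreal_times_indicator_borel continuous_intros)
  then have F2b[measurable]: "F2 \<in> borel_measurable lborel"
    unfolding F2_def[abs_def] using cl by simp
  have "(\<integral>\<^sup>+x\<in>\<Omega>. ennreal (norm (h x) * (sqrt (grad_sq \<phi> x) + \<eta>)) \<partial>lborel)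
      \<le> (\<integral>\<^sup>+x. ennreal \<eta> * F1 x + (ennreal (l / 2) * F2 x + ennreal (1 / (2 * l)) * F3 x) \<partial>lborel)"
  proof (rule nn_integral_mono)
    fix x
    show "ennreal (norm (h x) * (sqrt (grad_sq \<phi> x) + \<eta>)) * indicator \<Omega> x \<le>
      ennreal \<eta> * F1 x + (ennreal (l / 2) * F2 x + ennreal (1 / (2 * l)) * F3 x)"
    proof (cases "x \<in> \<Omega>")
      case True
      define n s where "n = norm (h x)" and "s = sqrt (grad_sq \<phi> x)"
      have s: "s \<ge> 0" "s\<^sup>2 = grad_sq \<phi> x" using g0[of x] by (auto simp: s_def)
      have n: "n \<ge> 0" by (simp add: n_def)
      show ?thesis
      proof (cases "infdist x (- \<Omega>) \<le> \<epsilon>")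
        case near: True
        \<comment> \<open>The weighted inequality between arithmetic and geometric means, as a
          completed square.\<close>
        have "0 \<le> (l * n - s)\<^sup>2 / (2 * l)" using l(1) by simp
        also have "\<dots> = l / 2 * n\<^sup>2 + 1 / (2 * l) * s\<^sup>2 - n * s"
          using l(1) by (simp add: power2_eq_square field_simps)
        finally have "n * (s + \<eta>) \<le> \<eta> * n + (l / 2 * n\<^sup>2 + 1 / (2 * l) * s\<^sup>2)"
          by (simp add: algebra_simps)
        then have "ennreal (n * (s + \<eta>)) \<le> ennreal (\<eta> * n + (l / 2 * n\<^sup>2 + 1 / (2 * l) * s\<^sup>2))"
          by (rule ennreal_leI)
        also have "\<dots> = ennreal \<eta> * ennreal n + (ennreal (l / 2) * ennreal (n\<^sup>2) + ennreal (1 / (2 * l)) * ennreal (s\<^sup>2))"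
          using l(1) \<eta>(1) n s(1) by (intro ennreal_linear3) auto
        finally show ?thesis using True near s(1)
          by (simp add: F1_def F2_def F3_def n_def[symmetric] s_def[symmetric] s(2)[symmetric])
      next
        case False
        then have "s = 0" using gU[of x] U(2) True by (auto simp: s_def)
        then have "ennreal (n * (s + \<eta>)) = ennreal \<eta> * ennreal n"
          using n \<eta>(1) by (simp add: ennreal_mult[symmetric] mult.commute)
        then show ?thesis using True
          by (simp add: F1_def n_def[symmetric] s_def[symmetric])
      qed
    qed simp
  qed
  also have "\<dots> = ennreal \<eta> * integral\<^sup>N lborel F1 + (ennreal (l / 2) * integral\<^sup>N lborel F2 + ennreal (1 / (2 * l)) * integral\<^sup>N lborel F3)"
    by (simp add: nn_integral_add nn_integral_cmult)
  also have "\<dots> \<le> ennreal \<eta> * ennreal i + (ennreal (l / 2) * ennreal T + ennreal (1 / (2 * l)) * ennreal E)"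
  proof -
    have "integral\<^sup>N lborel F2 =
        (\<integral>\<^sup>+x\<in>\<Omega>. ennreal ((norm (h x))\<^sup>2) * indicator {x. infdist x (- \<Omega>) \<le> \<epsilon>} x \<partial>lborel)"
      by (rule nn_integral_cong) (simp add: F2_def mult_ac)
    then have "integral\<^sup>N lborel F2 \<le> ennreal T" using T(1) by simp
    moreover have "integral\<^sup>N lborel F1 \<le> ennreal i" "integral\<^sup>N lborel F3 \<le> ennreal E"
      using i(1) E(1) unfolding F1_def[abs_def] F3_def[abs_def] by auto
    ultimately show ?thesis by (intro add_mono mult_left_mono) auto
  qed
  also have "\<dots> = ennreal (\<eta> * i + (l / 2 * T + 1 / (2 * l) * E))"
    using l(1) \<eta>(1) i(2) T(2) E(2) by (intro ennreal_linear3[symmetric]) auto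
  also have "\<dots> \<le> ennreal m" using \<eta>(2) l(2) by (intro ennreal_leI) simp
  finally have int: "(\<integral>\<^sup>+x\<in>\<Omega>. ennreal (norm (h x) * (sqrt (grad_sq \<phi> x) + \<eta>)) \<partial>lborel) \<le> ennreal m" .
  show ?thesis unfolding flux_cutoff_def
  proof (intro conjI)
    show "continuous_on UNIV \<phi>"
      using \<phi>(1) by (auto simp: test_functions_def dest: spec[of _ 0])
    show "\<forall>x. 0 \<le> \<phi> x \<and> \<phi> x \<le> 1" using \<phi>(2) by blast
    show "\<exists>K. compact K \<and> K \<subseteq> \<Omega> \<and> (\<forall>x. x \<notin> K \<longrightarrow> \<phi> x = 0)"
      using \<phi>(1) closure_subset[of "{x. \<phi> x \<noteq> 0}"]
      by (intro exI[of _ "closure {x. \<phi> x \<noteq> 0}"]) (auto simp: test_functions_def)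
    show "\<forall>x\<in>\<Omega>. m \<le> infdist x (- \<Omega>) \<longrightarrow> \<phi> x = 1" using U(2,3) m(2) by fastforce
    show "\<exists>\<kappa> t\<^sub>0. t\<^sub>0 > 0 \<and>
        (\<forall>x\<in>\<Omega>. \<forall>v\<in>Basis. \<forall>t. 0 < t \<and> t < t\<^sub>0 \<longrightarrow> \<bar>\<phi> (x + t *\<^sub>R v) - \<phi> x\<bar> \<le> t * \<kappa> x) \<and>
        (\<integral>\<^sup>+x\<in>\<Omega>. ennreal (norm (h x) * \<kappa> x) \<partial>lborel) \<le> ennreal m"
    proof (intro exI conjI ballI allI impI)
      fix x v t assume x: "x \<in> \<Omega>" and v: "v \<in> (Basis :: 'a set)" and t: "0 < t \<and> t < t\<^sub>0"
      have "\<bar>\<phi> (x + t *\<^sub>R v) - \<phi> x\<bar> \<le> t * (\<bar>frechet_derivative \<phi> (at x) v\<bar> + \<eta>)" using t0(2)[OF x v] t by blast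
      also have "\<dots> \<le> t * (sqrt (grad_sq \<phi> x) + \<eta>)" using gle[OF v, of x] t by (intro mult_left_mono) auto
      finally show "\<bar>\<phi> (x + t *\<^sub>R v) - \<phi> x\<bar> \<le> t * (sqrt (grad_sq \<phi> x) + \<eta>)" .
    qed (use t0(1) int in auto)
  qed
qed

section \<open>Weighted Bergman spaces\<close>

text \<open>For \<open>\<alpha> \<ge> 0\<close> the collar of width \<open>\<epsilon> j\<close>
  carries squared L^2 mass at most \<open>\<epsilon> j powr \<alpha> * J j\<close>, where
  \<open>J j\<close> is the tail of a convergent integral. Its product with an energy of order
  \<open>\<epsilon> j powr (-\<alpha>)\<close> tends to 0.\<close>

lemma bergman_zero_of_capacity:
  fixes \<Omega> :: "(complex ^ 'n) set"
  assumes \<Omega>: "open \<Omega>" "bounded \<Omega>" and f: "f \<in> weighted_bergman \<alpha> \<Omega>" and \<alpha>: "\<alpha> \<ge> 0"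
    and \<epsilon>: "\<And>j. \<epsilon> j > 0" "\<epsilon> \<longlonglongrightarrow> 0"
    and C: "\<forall>\<^sub>F j in sequentially.
              capacity (closure {z\<in>\<Omega>. bdist \<Omega> z > \<epsilon> j}) \<Omega> \<le> ennreal (C * \<epsilon> j powr (-\<alpha>))"
    and z: "z \<in> \<Omega>"
  shows "f z = 0"
proof -
  define d where "d x = infdist x (- \<Omega>)" for x
  have bd: "bdist \<Omega> x = d x" if "x \<in> \<Omega>" for x
    unfolding d_def using bdist_eq_infdist_Compl[OF \<Omega> that] .
  have dpos: "d x > 0" if "x \<in> \<Omega>" for x unfolding d_def using infdist_Compl_pos[OF \<Omega> that] .
  have dc: "continuous_on S d" for S unfolding d_def by (intro continuous_intros)
  obtain D where D: "D \<ge> 1" "\<And>x. d x \<le> D" unfolding d_def using infdist_Compl_bounded[OF \<Omega>(2)] by metis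
  have hol: "holomorphic_several_on f \<Omega>" using f by (simp add: weighted_bergman_def)
  have fc: "continuous_on \<Omega> f" using hol by (rule holomorphic_several_on_continuous)
  define F where "F x = (norm (f x))\<^sup>2 * d x powr (-\<alpha>)" for x
  have Fc: "continuous_on \<Omega> F"
    unfolding F_def using fc dc dpos by (intro continuous_intros) (auto simp: less_le)
  have F0: "F x \<ge> 0" for x by (simp add: F_def)
  have "(\<integral>\<^sup>+x\<in>\<Omega>. ennreal (F x) \<partial>lborel) = (\<integral>\<^sup>+z\<in>\<Omega>. ennreal ((norm (f z))\<^sup>2 * bdist \<Omega> z powr (-\<alpha>)) \<partial>lborel)"
    by (intro nn_integral_cong) (auto simp: indicator_def F_def bd)
  then have Ffin: "(\<integral>\<^sup>+x\<in>\<Omega>. ennreal (F x) \<partial>lborel) < \<infinity>" using f by (simp add: weighted_bergman_def)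
  have sq: "(norm (f x))\<^sup>2 = d x powr \<alpha> * F x" if "x \<in> \<Omega>" for x
    using dpos[OF that] by (simp add: F_def powr_minus field_simps)
  \<comment> \<open>A bounded set has finite volume, so |f| \<le> 1 + |f|^2 gives integrability of
    \<open>f\<close>; \<open>\<alpha> \<ge> 0\<close> and the bound \<open>D\<close> remove the
    weight.\<close>
  have fin1: "(\<integral>\<^sup>+x\<in>\<Omega>. ennreal (norm (f x)) \<partial>lborel) < \<infinity>"
  proof (rule nn_integral_finite_bound[where c = 1 and g = "\<lambda>x. 1 + D powr \<alpha> * F x"])
    have b[measurable]: "(\<lambda>x. ennreal (F x) * indicator \<Omega> x) \<in> borel_measurable lborel"
      using ennreal_times_indicator_borel[OF \<Omega>(1) Fc] by simp
    have [measurable]: "\<Omega> \<in> sets lborel" using \<Omega>(1) by simp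
    have "(\<integral>\<^sup>+x\<in>\<Omega>. ennreal (1 + D powr \<alpha> * F x) \<partial>lborel)
        = (\<integral>\<^sup>+x. indicator \<Omega> x + ennreal (D powr \<alpha>) * (ennreal (F x) * indicator \<Omega> x) \<partial>lborel)"
      by (intro nn_integral_cong) (auto simp: indicator_def F0 ennreal_mult)
    also have "\<dots> = emeasure lborel \<Omega> + ennreal (D powr \<alpha>) * (\<integral>\<^sup>+x\<in>\<Omega>. ennreal (F x) \<partial>lborel)"
      using \<Omega>(1) by (simp add: nn_integral_add nn_integral_cmult)
    also have "\<dots> < \<infinity>"
      using Ffin emeasure_bounded_finite[OF \<Omega>(2)] by (simp add: ennreal_mult_less_top)
    finally show "(\<integral>\<^sup>+x\<in>\<Omega>. ennreal (1 + D powr \<alpha> * F x) \<partial>lborel) < \<infinity>" .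
    show "continuous_on \<Omega> (\<lambda>x. 1 + D powr \<alpha> * F x)" using Fc by (intro continuous_intros)
    show "norm (f x) \<le> 1 * (1 + D powr \<alpha> * F x)" if "x \<in> \<Omega>" for x
    proof -
      have "2 * norm (f x) \<le> 1 + (norm (f x))\<^sup>2"
        using sum_squares_bound[of 1 "norm (f x)"] by simp
      moreover have "(norm (f x))\<^sup>2 \<le> D powr \<alpha> * F x"
        unfolding sq[OF that] using dpos[OF that] D(2)[of x] \<alpha> F0[of x]
        by (intro mult_right_mono powr_mono2) auto
      moreover have "0 \<le> D powr \<alpha> * F x" using F0[of x] by simp
      ultimately show ?thesis by simp
    qed
  qed (use \<Omega> in auto)
  define G where "G j x = indicator \<Omega> x * F x * indicator {x. d x \<le> \<epsilon> j} x" for j x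
  have Gb: "G j \<in> borel_measurable lborel" for j
  proof -
    have "closed {x. d x \<le> \<epsilon> j}" using dc by (intro closed_Collect_le continuous_intros)
    then have "{x. d x \<le> \<epsilon> j} \<in> sets borel" by simp
    moreover have "(\<lambda>x. indicator \<Omega> x * F x) \<in> borel_measurable borel"
      using borel_measurable_continuous_on_indicator[OF _ Fc] \<Omega>(1) by simp
    ultimately show ?thesis unfolding G_def[abs_def] by simp
  qed
  have Fi: "integrable lborel (\<lambda>x. indicator \<Omega> x * F x)"
  proof (rule integrableI_bounded)
    show "(\<lambda>x. indicator \<Omega> x * F x) \<in> borel_measurable lborel"
      using borel_measurable_continuous_on_indicator[OF _ Fc] \<Omega>(1) by simp
    have "(\<integral>\<^sup>+x. ennreal (norm (indicator \<Omega> x * F x)) \<partial>lborel) = (\<integral>\<^sup>+x\<in>\<Omega>. ennreal (F x) \<partial>lborel)"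
      by (intro nn_integral_cong) (auto simp: indicator_def F0)
    then show "(\<integral>\<^sup>+x. ennreal (norm (indicator \<Omega> x * F x)) \<partial>lborel) < \<infinity>" using Ffin by simp
  qed
  have Gle: "norm (G j x) \<le> indicator \<Omega> x * F x" for j x by (auto simp: G_def indicator_def F0)
  have Gi: "integrable lborel (G j)" for j
    by (rule Bochner_Integration.integrable_bound[OF Fi Gb])
      (use Gle in \<open>auto intro: order_trans simp: F0 abs_mult\<close>)
  have Glim: "(\<lambda>j. G j x) \<longlonglongrightarrow> 0" for x
  proof (cases "x \<in> \<Omega>")
    case True
    have "\<forall>\<^sub>F j in sequentially. \<epsilon> j < d x" using order_tendstoD(2)[OF \<epsilon>(2) dpos[OF True]] .
    then have "\<forall>\<^sub>F j in sequentially. G j x = 0" by eventually_elim (simp add: G_def)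
    then show ?thesis by (rule tendsto_eventually)
  qed (simp add: G_def)
  define J where "J j = (LINT x|lborel. G j x)" for j
  have J0: "J j \<ge> 0" for j unfolding J_def by (intro Bochner_Integration.integral_nonneg) (simp add: G_def F0)
  \<comment> \<open>The collars shrink away from every point of \<open>\<Omega>\<close>, and the
    weighted density of \<open>f\<close> dominates.\<close>
  have "J \<longlonglongrightarrow> (LINT x|(lborel :: (complex ^ 'n) measure). (0::real))"
    unfolding J_def[abs_def]
  proof (rule integral_dominated_convergence[where s = G and f = "\<lambda>x. 0" and w = "\<lambda>x. indicator \<Omega> x * F x"])
    show "AE x in lborel. (\<lambda>j. G j x) \<longlonglongrightarrow> 0" using Glim by simp
    show "AE x in lborel. norm (G j x) \<le> indicator \<Omega> x * F x" for j using Gle by simp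
  qed (use Fi Gb in auto)
  then have Jlim: "J \<longlonglongrightarrow> 0" by simp
  have near: "(\<integral>\<^sup>+x\<in>\<Omega>. ennreal ((norm (f x))\<^sup>2) * indicator {x. infdist x (- \<Omega>) \<le> \<epsilon> j} x \<partial>lborel)
      \<le> ennreal (\<epsilon> j powr \<alpha> * J j)" for j
  proof -
    have "(\<integral>\<^sup>+x\<in>\<Omega>. ennreal ((norm (f x))\<^sup>2) * indicator {x. infdist x (- \<Omega>) \<le> \<epsilon> j} x \<partial>lborel)
        \<le> (\<integral>\<^sup>+x. ennreal (\<epsilon> j powr \<alpha> * G j x) \<partial>lborel)"
    proof (rule nn_integral_mono)
      fix x
      show "ennreal ((norm (f x))\<^sup>2) * indicator {x. infdist x (- \<Omega>) \<le> \<epsilon> j} x * indicator \<Omega> x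
          \<le> ennreal (\<epsilon> j powr \<alpha> * G j x)"
      proof (cases "x \<in> \<Omega> \<and> d x \<le> \<epsilon> j")
        case True
        have "(norm (f x))\<^sup>2 \<le> \<epsilon> j powr \<alpha> * F x"
          using True dpos[of x] \<alpha> F0[of x] by (subst sq) (auto intro!: mult_right_mono powr_mono2)
        then show ?thesis using True by (simp add: G_def d_def[symmetric] ennreal_leI)
      qed (auto simp: d_def indicator_def)
    qed
    also have "\<dots> = ennreal (LINT x|lborel. \<epsilon> j powr \<alpha> * G j x)"
    proof (rule nn_integral_eq_integral)
      show "integrable lborel (\<lambda>x. \<epsilon> j powr \<alpha> * G j x)" using Gi by (intro integrable_mult_right)
      show "AE x in lborel. 0 \<le> \<epsilon> j powr \<alpha> * G j x" by (simp add: G_def F0)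
    qed
    also have "\<dots> = ennreal (\<epsilon> j powr \<alpha> * J j)" by (simp add: J_def)
    finally show ?thesis .
  qed
  have "\<exists>\<phi>. flux_cutoff \<Omega> f m \<phi>" if m: "m > 0" for m
  proof -
    \<comment> \<open>This value makes the energy term equal \<open>m / 4\<close>; requiring
      \<open>J j < m / (2 * l)\<close> makes the collar term at most \<open>m / 4\<close>.\<close>
    define l where "l = 2 * (\<bar>C\<bar> + 1) / m"
    have l: "l > 0" using m by (simp add: l_def add_nonneg_pos)
    have "\<forall>\<^sub>F j in sequentially. J j < m / (2 * l)"
      by (rule order_tendstoD(2)[OF Jlim]) (use m l in simp)
    moreover have "\<forall>\<^sub>F j in sequentially. \<epsilon> j < m" by (rule order_tendstoD(2)[OF \<epsilon>(2) m])
    ultimately have "\<forall>\<^sub>F j in sequentially. J j < m / (2 * l) \<and> \<epsilon> j < m \<and>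
        capacity (closure {z\<in>\<Omega>. bdist \<Omega> z > \<epsilon> j}) \<Omega> \<le> ennreal (C * \<epsilon> j powr (-\<alpha>))"
      using C by eventually_elim auto
    then obtain j where j: "J j < m / (2 * l)" "\<epsilon> j < m"
        "capacity (closure {z\<in>\<Omega>. bdist \<Omega> z > \<epsilon> j}) \<Omega> \<le> ennreal (C * \<epsilon> j powr (-\<alpha>))"
      using eventually_happens'[OF sequentially_bot] by blast
    have p: "\<epsilon> j powr (-\<alpha>) > 0" "\<epsilon> j powr \<alpha> > 0" "\<epsilon> j powr \<alpha> * \<epsilon> j powr (-\<alpha>) = 1"
      using \<epsilon>(1)[of j] by (auto simp: powr_minus)
    \<comment> \<open>The excess \<open>\<bar>C\<bar> + 1\<close> puts the capacity strictly below
      \<open>E\<close>, so the infimum has a competitor below \<open>E\<close>; it also keeps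
      \<open>E\<close> positive when \<open>C\<close> is not.\<close>
    define E where "E = (\<bar>C\<bar> + 1) * \<epsilon> j powr (-\<alpha>)"
    have E: "E > 0" using p by (simp add: E_def add_nonneg_pos)
    have "C * \<epsilon> j powr (-\<alpha>) < E" unfolding E_def using p(1) by (intro mult_strict_right_mono) auto
    then have "ennreal (C * \<epsilon> j powr (-\<alpha>)) < ennreal E" using E by (simp add: ennreal_less_iff ennreal_lessI)
    with j(3) have "capacity (closure {z\<in>\<Omega>. bdist \<Omega> z > \<epsilon> j}) \<Omega> < ennreal E" by (rule order_le_less_trans)
    then obtain \<phi> U where \<phi>: "\<phi> \<in> test_functions \<Omega>" "\<forall>x. 0 \<le> \<phi> x \<and> \<phi> x \<le> 1"
      and U: "open U" "closure {z\<in>\<Omega>. bdist \<Omega> z > \<epsilon> j} \<subseteq> U" "\<forall>x\<in>U. \<phi> x = 1"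
      and en: "(\<integral>\<^sup>+x\<in>\<Omega>. ennreal (grad_sq \<phi> x) \<partial>lborel) < ennreal E"
      unfolding capacity_def INF_less_iff by blast
    have "{z\<in>\<Omega>. infdist z (- \<Omega>) > \<epsilon> j} = {z\<in>\<Omega>. bdist \<Omega> z > \<epsilon> j}" using bd by (auto simp: d_def)
    then have U': "{z\<in>\<Omega>. infdist z (- \<Omega>) > \<epsilon> j} \<subseteq> U" using U(2) closure_subset by blast
    \<comment> \<open>Scaling the weight by \<open>\<epsilon> j powr (-\<alpha>)\<close> cancels the
      powers of \<open>\<epsilon> j\<close> in both terms.\<close>
    define L where "L = l * \<epsilon> j powr (-\<alpha>)"
    have L: "L > 0" using l p by (simp add: L_def)
    have "L / 2 * (\<epsilon> j powr \<alpha> * J j) = l / 2 * J j * (\<epsilon> j powr \<alpha> * \<epsilon> j powr (-\<alpha>))"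
      by (simp add: L_def mult_ac)
    also have "\<dots> \<le> m / 4" using j(1) l unfolding p(3) by (simp add: field_simps)
    finally have b1: "L / 2 * (\<epsilon> j powr \<alpha> * J j) \<le> m / 4" .
    have "E / (2 * L) = (\<bar>C\<bar> + 1) / (2 * l)" using p(1) by (simp add: E_def L_def)
    also have "\<dots> = m / 4" using m by (simp add: l_def field_simps)
    finally have b2: "E / (2 * L) = m / 4" .
    have "flux_cutoff \<Omega> f m \<phi>"
    proof (rule test_function_flux_cutoff[OF \<Omega> fc fin1 \<phi>(1) _ U(1) U' _ _ _ near[of j] _ L, where E = E])
      show "L / 2 * (\<epsilon> j powr \<alpha> * J j) + E / (2 * L) \<le> m / 2" using b1 b2 by linarith
      show "0 \<le> \<epsilon> j powr \<alpha> * J j" using p(2) J0[of j] by simp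
    qed (use \<phi>(2) U(3) en E m j(2) in auto)
    then show ?thesis by blast
  qed
  then show ?thesis
    by (rule flux_cutoff_imp_zero[OF \<Omega> hol set_integrable_lborelI[OF \<Omega>(1) fc fin1] _ z])
qed

text \<open>Squaring preserves holomorphy and turns the quadratic hypothesis on \<open>f\<close>
  into a weighted L^1 bound on \<open>h\<close>, the form in which the flux of a logarithmic cutoff
  is measured.\<close>

lemma holomorphic_zero_of_log_weight:
  fixes \<Omega> :: "(complex ^ 'n) set"
  assumes \<Omega>: "open \<Omega>" "bounded \<Omega>" and f: "holomorphic_several_on f \<Omega>"
    and fin: "(\<integral>\<^sup>+z\<in>\<Omega>. ennreal ((cmod (f z))\<^sup>2 * inverse (bdist \<Omega> z)
                 * inverse (1 + \<bar>ln (bdist \<Omega> z)\<bar>)) \<partial>lborel) < \<infinity>"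
    and z: "z \<in> \<Omega>"
  shows "f z = 0"
proof -
  define d where "d x = infdist x (- \<Omega>)" for x
  have bd: "bdist \<Omega> x = d x" if "x \<in> \<Omega>" for x
    unfolding d_def using bdist_eq_infdist_Compl[OF \<Omega> that] .
  have dpos: "d x > 0" if "x \<in> \<Omega>" for x unfolding d_def using infdist_Compl_pos[OF \<Omega> that] .
  have dc: "continuous_on S d" for S unfolding d_def by (intro continuous_intros)
  obtain D where D: "D \<ge> 1" "\<And>x. d x \<le> D" unfolding d_def using infdist_Compl_bounded[OF \<Omega>(2)] by metis
  have fc: "continuous_on \<Omega> f" using f by (rule holomorphic_several_on_continuous)
  define h where "h x = (f x)\<^sup>2" for x
  have hol: "holomorphic_several_on h \<Omega>" unfolding holomorphic_several_on_def
  proof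
    fix x assume "x \<in> \<Omega>"
    then obtain A where A: "(f has_derivative A) (at x)" "\<And>c v. A (c *s v) = c * A v"
      using f unfolding holomorphic_several_on_def by blast
    have "(h has_derivative (\<lambda>v. f x * A v + A v * f x)) (at x)"
      unfolding h_def power2_eq_square using A(1) by (intro has_derivative_mult)
    then show "\<exists>B. (h has_derivative B) (at x) \<and> (\<forall>c v. B (c *s v) = c * B v)"
      by (intro exI[of _ "\<lambda>v. f x * A v + A v * f x"]) (auto simp: A(2) algebra_simps)
  qed
  have hc: "continuous_on \<Omega> h" using hol by (rule holomorphic_several_on_continuous)
  define w where "w x = norm (h x) / (d x * (1 + ln D - ln (d x)))" for x
  have A: "1 + ln D - ln (d x) \<ge> 1" if "x \<in> \<Omega>" for x using dpos[OF that] D(2)[of x] by simp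
  have wc: "continuous_on \<Omega> w"
    unfolding w_def using hc dc dpos A by (intro continuous_intros) (force simp: less_le)+
  define g where "g x = (norm (f x))\<^sup>2 * inverse (d x) * inverse (1 + \<bar>ln (d x)\<bar>)" for x
  have gc: "continuous_on \<Omega> g"
    unfolding g_def using fc dc dpos
    by (intro continuous_intros) (auto simp: less_le add_nonneg_eq_0_iff)
  have "(\<integral>\<^sup>+x\<in>\<Omega>. ennreal (g x) \<partial>lborel) = (\<integral>\<^sup>+z\<in>\<Omega>. ennreal ((cmod (f z))\<^sup>2 * inverse (bdist \<Omega> z)
                 * inverse (1 + \<bar>ln (bdist \<Omega> z)\<bar>)) \<partial>lborel)"
    by (intro nn_integral_cong) (auto simp: indicator_def g_def bd)
  with fin have gfin: "(\<integral>\<^sup>+x\<in>\<Omega>. ennreal (g x) \<partial>lborel) < \<infinity>" by simp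
  have lD: "ln D \<ge> 0" using D(1) by simp
  have wle: "w x \<le> (1 + ln D) * g x" if x: "x \<in> \<Omega>" for x
  proof -
    have "ln (d x) \<le> ln D" using dpos[OF x] D(2)[of x] by simp
    \<comment> \<open>Where the distance is below 1 the two weights compare directly because
      \<open>ln D \<ge> 0\<close>; elsewhere |ln d| \<le> ln D, which the factor
      \<open>1 + ln D\<close> absorbs.\<close>
    then have "1 * (1 + \<bar>ln (d x)\<bar>) \<le> (1 + ln D) * (1 + ln D - ln (d x))"
    proof (cases "ln (d x) \<ge> 0")
      case True
      then have "1 * (1 + \<bar>ln (d x)\<bar>) \<le> (1 + ln D) * 1" using \<open>ln (d x) \<le> ln D\<close> by simp
      also have "\<dots> \<le> (1 + ln D) * (1 + ln D - ln (d x))"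
        using A[OF x] lD by (intro mult_left_mono) auto
      finally show ?thesis .
    next
      case False
      then have "1 * (1 + \<bar>ln (d x)\<bar>) \<le> 1 * (1 + ln D - ln (d x))" using lD by simp
      also have "\<dots> \<le> (1 + ln D) * (1 + ln D - ln (d x))"
        using A[OF x] lD by (intro mult_right_mono) auto
      finally show ?thesis .
    qed
    moreover have "1 / a \<le> c / b" if "1 * b \<le> c * a" "0 < a" "0 < b" for a b c :: real
      using that by (simp add: field_simps)
    ultimately have "1 / (1 + ln D - ln (d x)) \<le> (1 + ln D) / (1 + \<bar>ln (d x)\<bar>)"
      using A[OF x] by (simp add: add_pos_nonneg)
    then have "norm (h x) / d x * (1 / (1 + ln D - ln (d x))) \<le> norm (h x) / d x * ((1 + ln D) / (1 + \<bar>ln (d x)\<bar>))"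
      using dpos[OF x] by (intro mult_left_mono) auto
    then show ?thesis by (simp add: w_def g_def h_def norm_power divide_inverse mult_ac)
  qed
  have wfin: "(\<integral>\<^sup>+x\<in>\<Omega>. ennreal (w x) \<partial>lborel) < \<infinity>"
    by (rule nn_integral_finite_bound[OF \<Omega>(1) gc gfin _ wle]) (use lD in auto)
  \<comment> \<open>By monotonicity of s (1 + ln (D/s)) its value at the distance is at most its
    value \<open>D\<close> at s = D, so the weighted bound implies plain integrability.\<close>
  have hle: "norm (h x) \<le> D * w x" if x: "x \<in> \<Omega>" for x
  proof -
    have pos: "d x * (1 + ln D - ln (d x)) > 0" using dpos[OF x] A[OF x] by (intro mult_pos_pos) auto
    have "norm (h x) = (d x * (1 + ln D - ln (d x))) * w x" using less_imp_neq[OF pos] by (simp add: w_def)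
    also have "\<dots> \<le> (D * (1 + ln D - ln D)) * w x"
      using pos times_log_mono[OF dpos[OF x] D(2), of D] by (intro mult_right_mono) (auto simp: w_def)
    finally show ?thesis by simp
  qed
  have hfin: "(\<integral>\<^sup>+x\<in>\<Omega>. ennreal (norm (h x)) \<partial>lborel) < \<infinity>"
    by (rule nn_integral_finite_bound[OF \<Omega>(1) wc wfin _ hle]) (use D in auto)
  have "h z = 0"
  proof (rule flux_cutoff_imp_zero[OF \<Omega> hol set_integrable_lborelI[OF \<Omega>(1) hc hfin] _ z])
    show "\<exists>\<phi>. flux_cutoff \<Omega> h m \<phi>" if "m > 0" for m
      using log_flux_cutoff[OF \<Omega> hc, of D m] D wfin that by (simp add: w_def d_def)
  qed
  then show ?thesis by (simp add: h_def)
qed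

section \<open>From vanishing on the domain to triviality of the space\<close>

lemma zero_in_weighted_bergman: "(\<lambda>z. 0) \<in> weighted_bergman \<alpha> \<Omega>"
  unfolding weighted_bergman_def holomorphic_several_on_def
  by (auto intro!: exI[of _ "\<lambda>_. 0"])

lemma weighted_bergman_eq_zeroI:
  assumes "\<And>f z. f \<in> weighted_bergman \<alpha> \<Omega> \<Longrightarrow> z \<in> \<Omega> \<Longrightarrow> f z = 0"
  shows "weighted_bergman \<alpha> \<Omega> = {\<lambda>z. 0}"
proof -
  have "f = (\<lambda>z. 0)" if "f \<in> weighted_bergman \<alpha> \<Omega>" for f
    using assms[OF that] that by (fastforce simp: weighted_bergman_def)
  then show ?thesis using zero_in_weighted_bergman by blast
qed

text \<open>Since the distance is at most \<open>D\<close> and \<open>\<alpha> \<ge> 1\<close>, its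
  inverse is at most \<open>D powr (\<alpha> - 1)\<close> times its power \<open>-\<alpha>\<close>,
  and the logarithmic factor only helps.\<close>

lemma weighted_bergman_zero_of_ge_1:
  fixes \<Omega> :: "(complex ^ 'n) set"
  assumes \<Omega>: "open \<Omega>" "bounded \<Omega>" and \<alpha>: "\<alpha> \<ge> 1"
  shows "weighted_bergman \<alpha> \<Omega> = {\<lambda>z. 0}"
proof (rule weighted_bergman_eq_zeroI)
  fix f z assume f: "f \<in> weighted_bergman \<alpha> \<Omega>" and z: "z \<in> \<Omega>"
  have hol: "holomorphic_several_on f \<Omega>" using f by (simp add: weighted_bergman_def)
  obtain D where D: "D \<ge> 1" "\<And>x. infdist x (- \<Omega>) \<le> D" using infdist_Compl_bounded[OF \<Omega>(2)] by metis
  have b: "0 < bdist \<Omega> x" "bdist \<Omega> x \<le> D" if "x \<in> \<Omega>" for x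
    using infdist_Compl_pos[OF \<Omega> that] D(2)[of x] bdist_eq_infdist_Compl[OF \<Omega> that] by auto
  have "(\<integral>\<^sup>+z\<in>\<Omega>. ennreal ((cmod (f z))\<^sup>2 * inverse (bdist \<Omega> z) * inverse (1 + \<bar>ln (bdist \<Omega> z)\<bar>)) \<partial>lborel) < \<infinity>"
  proof (rule nn_integral_finite_bound[OF \<Omega>(1), where c = "D powr (\<alpha> - 1)" and g = "\<lambda>z. (cmod (f z))\<^sup>2 * bdist \<Omega> z powr (-\<alpha>)"])
    show "continuous_on \<Omega> (\<lambda>z. (cmod (f z))\<^sup>2 * bdist \<Omega> z powr (-\<alpha>))"
      unfolding bdist_def using holomorphic_several_on_continuous[OF hol] b
      by (intro continuous_intros) (auto simp: bdist_def less_le)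
    fix x assume x: "x \<in> \<Omega>"
    have "inverse (bdist \<Omega> x) = bdist \<Omega> x powr ((\<alpha> - 1) + (-\<alpha>))"
      using b[OF x] by (simp add: powr_minus)
    also have "\<dots> = bdist \<Omega> x powr (\<alpha> - 1) * bdist \<Omega> x powr (-\<alpha>)" by (rule powr_add)
    also have "\<dots> \<le> D powr (\<alpha> - 1) * bdist \<Omega> x powr (-\<alpha>)"
      using b[OF x] \<alpha> by (intro mult_right_mono powr_mono2) auto
    finally have "inverse (bdist \<Omega> x) * inverse (1 + \<bar>ln (bdist \<Omega> x)\<bar>) \<le> (D powr (\<alpha> - 1) * bdist \<Omega> x powr (-\<alpha>)) * 1"
      using b[OF x] by (intro mult_mono) (auto intro: inverse_le_1_iff[THEN iffD2])
    then have "(cmod (f x))\<^sup>2 * (inverse (bdist \<Omega> x) * inverse (1 + \<bar>ln (bdist \<Omega> x)\<bar>)) \<le>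
        (cmod (f x))\<^sup>2 * ((D powr (\<alpha> - 1) * bdist \<Omega> x powr (-\<alpha>)) * 1)"
      by (intro mult_left_mono) auto
    then show "(cmod (f x))\<^sup>2 * inverse (bdist \<Omega> x) * inverse (1 + \<bar>ln (bdist \<Omega> x)\<bar>) \<le>
        D powr (\<alpha> - 1) * ((cmod (f x))\<^sup>2 * bdist \<Omega> x powr (-\<alpha>))" by (simp add: mult_ac)
  qed (use f in \<open>auto simp: weighted_bergman_def\<close>)
  then show "f z = 0" using holomorphic_zero_of_log_weight[OF \<Omega> hol _ z] by blast
qed

lemma indicator_in_weighted_bergman_0:
  fixes \<Omega> :: "(complex ^ 'n) set"
  assumes "open \<Omega>" "bounded \<Omega>"
  shows "indicator \<Omega> \<in> weighted_bergman 0 \<Omega>"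
proof -
  have "holomorphic_several_on (indicator \<Omega>) \<Omega>" unfolding holomorphic_several_on_def
  proof
    fix z assume "z \<in> \<Omega>"
    have "((indicator \<Omega> :: _ \<Rightarrow> complex) has_derivative (\<lambda>_. 0)) (at z)"
      by (rule has_derivative_transform_within_open[OF has_derivative_const[of 1] assms(1) \<open>z \<in> \<Omega>\<close>]) simp
    then show "\<exists>D. ((indicator \<Omega> :: _ \<Rightarrow> complex) has_derivative D) (at z) \<and> (\<forall>c v. D (c *s v) = c * D v)"
      by (intro exI[of _ "\<lambda>_. 0"]) simp
  qed
  moreover have "(\<integral>\<^sup>+z\<in>\<Omega>. ennreal ((cmod (indicator \<Omega> z))\<^sup>2 * bdist \<Omega> z powr (-0)) \<partial>lborel) < \<infinity>"
  proof -
    have "(\<integral>\<^sup>+z\<in>\<Omega>. ennreal ((cmod (indicator \<Omega> z))\<^sup>2 * bdist \<Omega> z powr (-0)) \<partial>lborel) \<le> (\<integral>\<^sup>+z. indicator \<Omega> z \<partial>lborel)"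
      \<comment> \<open>A zeroth \<open>powr\<close> is 1, except that base 0 gives 0; either way
        the integrand is at most the indicator.\<close>
      by (intro nn_integral_mono) (auto simp: indicator_def powr_def)
    also have "\<dots> < \<infinity>" using assms emeasure_bounded_finite[of \<Omega>] by simp
    finally show ?thesis .
  qed
  ultimately show ?thesis by (simp add: weighted_bergman_def)
qed

lemma weighted_bergman_zero_of_capacity:
  fixes \<Omega> :: "(complex ^ 'n) set"
  assumes \<Omega>: "open \<Omega>" "bounded \<Omega>"
    and \<epsilon>: "\<And>j. \<epsilon> j > 0" "\<epsilon> \<longlonglongrightarrow> 0"
    and C: "\<forall>\<^sub>F j in sequentially.
              capacity (closure {z\<in>\<Omega>. bdist \<Omega> z > \<epsilon> j}) \<Omega> \<le> ennreal (C * \<epsilon> j powr (-\<alpha>))"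
  shows "weighted_bergman \<alpha> \<Omega> = {\<lambda>z. 0}"
proof (rule weighted_bergman_eq_zeroI)
  fix f z assume f: "f \<in> weighted_bergman \<alpha> \<Omega>" and z: "z \<in> \<Omega>"
  show "f z = 0"
  proof (cases "\<alpha> \<ge> 0")
    case True
    then show ?thesis using bergman_zero_of_capacity[OF \<Omega> f True \<epsilon> C z] by blast
  next
    case False
    \<comment> \<open>Once \<open>\<epsilon> j < 1\<close>, the positive exponent
      \<open>-\<alpha>\<close> gives a power at most 1, so the capacities are bounded by
      \<open>\<bar>C\<bar>\<close>, which is the hypothesis for exponent 0.\<close>
    have "\<forall>\<^sub>F j in sequentially. \<epsilon> j < 1" by (rule order_tendstoD(2)[OF \<epsilon>(2)]) simp
    with C have "\<forall>\<^sub>F j in sequentially.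
        capacity (closure {z\<in>\<Omega>. bdist \<Omega> z > \<epsilon> j}) \<Omega> \<le> ennreal (\<bar>C\<bar> * \<epsilon> j powr (-0))"
    proof eventually_elim
      case (elim j)
      have "\<epsilon> j powr (-\<alpha>) \<le> 1" using elim \<epsilon>(1)[of j] False by (intro powr_le1) auto
      then have "C * \<epsilon> j powr (-\<alpha>) \<le> \<bar>C\<bar> * 1" by (intro mult_mono) auto
      then have "ennreal (C * \<epsilon> j powr (-\<alpha>)) \<le> ennreal (\<bar>C\<bar> * \<epsilon> j powr (-0))"
        using \<epsilon>(1)[of j] by (intro ennreal_leI) simp
      with elim show ?case by (meson order_trans)
    qed
    \<comment> \<open>The indicator would have to be 0 at \<open>z\<close>, where it is 1: this case
      is contradictory.\<close>
    from bergman_zero_of_capacity[OF \<Omega> indicator_in_weighted_bergman_0[OF \<Omega>] _ \<epsilon> this z]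
    show ?thesis using z by simp
  qed
qed

theorem theorem1p9:
  fixes \<Omega> :: "(complex ^ 'n) set"
  assumes "open \<Omega>" and "connected \<Omega>" and "\<Omega> \<noteq> {}" and "bounded \<Omega>"
  shows "((\<forall>f. holomorphic_several_on f \<Omega> \<and>
             (\<integral>\<^sup>+z\<in>\<Omega>. ennreal ((cmod (f z))\<^sup>2 * inverse (bdist \<Omega> z)
                 * inverse (1 + \<bar>ln (bdist \<Omega> z)\<bar>)) \<partial>lborel) < \<infinity>
             \<longrightarrow> (\<forall>z\<in>\<Omega>. f z = 0)) \<and>
          (\<forall>\<alpha>\<ge>1. weighted_bergman \<alpha> \<Omega> = {\<lambda>z. 0}))
       \<and> (\<forall>(\<alpha>::real) (\<epsilon> :: nat \<Rightarrow> real).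
            (\<forall>j. \<epsilon> j > 0) \<and> \<epsilon> \<longlonglongrightarrow> 0 \<and>
            (\<exists>C::real. \<forall>\<^sub>F j in sequentially.
               capacity (closure {z\<in>\<Omega>. bdist \<Omega> z > \<epsilon> j}) \<Omega> \<le> ennreal (C * \<epsilon> j powr (-\<alpha>)))
            \<longrightarrow> weighted_bergman \<alpha> \<Omega> = {\<lambda>z. 0})"
proof (intro conjI allI impI)
  fix f z assume "holomorphic_several_on f \<Omega> \<and>
             (\<integral>\<^sup>+z\<in>\<Omega>. ennreal ((cmod (f z))\<^sup>2 * inverse (bdist \<Omega> z)
                 * inverse (1 + \<bar>ln (bdist \<Omega> z)\<bar>)) \<partial>lborel) < \<infinity>"
  then show "\<forall>z\<in>\<Omega>. f z = 0"
    using holomorphic_zero_of_log_weight[OF assms(1,4)] by blast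
next
  fix \<alpha> :: real assume "1 \<le> \<alpha>"
  then show "weighted_bergman \<alpha> \<Omega> = {\<lambda>z. 0}"
    by (rule weighted_bergman_zero_of_ge_1[OF assms(1,4)])
next
  fix \<alpha> :: real and \<epsilon> :: "nat \<Rightarrow> real"
  assume "(\<forall>j. \<epsilon> j > 0) \<and> \<epsilon> \<longlonglongrightarrow> 0 \<and>
            (\<exists>C::real. \<forall>\<^sub>F j in sequentially.
               capacity (closure {z\<in>\<Omega>. bdist \<Omega> z > \<epsilon> j}) \<Omega> \<le> ennreal (C * \<epsilon> j powr (-\<alpha>)))"
  then show "weighted_bergman \<alpha> \<Omega> = {\<lambda>z. 0}"
    using weighted_bergman_zero_of_capacity[OF assms(1,4)] by blast
qed

end
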